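(* Let $\mathcal{R}=\mathbb{C}[\partial]A\oplus\mathbb{C}[\partial]B$ be a solvable rank two Lie conformal algebra with structure polynomials $p(\lambda)$ and $Q_1(\partial,\lambda)$, let $V_{\phi_A,\phi_B}=\mathbb{C}[\partial]v$ be a nontrivial finite irreducible $\mathcal{R}$-module, and let $\eta\in\mathbb{C}$. Consider extensions of $\mathcal{R}$-modules of the form $$0\longrightarrow\mathbb{C}c_\eta\longrightarrow E\longrightarrow V_{\phi_A,\phi_B}\longrightarrow0 .\qquad(\ast)$$ Every such $E$ is, as a vector space, $\mathbb{C}c_\eta\oplus\mathbb{C}[\partial]v$ with $\mathcal{R}_\lambda c_\eta=0$, $\partial c_\eta=\eta c_\eta$ and $$A_\lambda v=\phi_A(\lambda)v+f(\lambda)c_\eta,\qquad B_\lambda v=\phi_B(\lambda)v+g(\lambda)c_\eta\qquad(\ast\ast)$$ for some $f(\lambda),g(\lambda)\in\mathbb{C}[\lambda]$. Nontrivial extensions of the form $(\ast)$ exist only if $p(\lambda)\neq0$ and $Q_1(\partial,\lambda)=0$. Moreover, they are given (up to equivalence) by $(\ast\ast)$ with the following data: $\eta\in\mathbb{C}$ arbitrary, $\phi_A(\lambda)=-p(\lambda)$, $\phi_B(\lambda)=0$, $f(\lambda)=0$, and $g(\lambda)$ a nonzero constant. Thus, when $p(\lambda)\neq0$ and $Q_1(\partial,\lambda)=0$, $\dim\mathrm{Ext}(V_{\phi_A,\phi_B},\mathbb{C}c_\eta)=\delta_{\phi_A(\lambda)+p(\lambda),0}$ (Kronecker delta: $1$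 if $\phi_A+p=0$, and $0$ otherwise).
   Context: Everything is over $\mathbb{C}$. A Lie conformal algebra $\mathcal{R}$ is a $\mathbb{C}[\partial]$-module with a $\mathbb{C}$-linear $\lambda$-bracket $\mathcal{R}\otimes\mathcal{R}\to\mathcal{R}[\lambda]$, $a\otimes b\mapsto[a_\lambda b]$, satisfying $[\partial a_\lambda b]=-\lambda[a_\lambda b]$, $[a_\lambda\partial b]=(\partial+\lambda)[a_\lambda b]$, $[a_\lambda b]=-[b_{-\lambda-\partial}a]$ and $[a_\lambda[b_\mu c]]=[[a_\lambda b]_{\lambda+\mu}c]+[b_\mu[a_\lambda c]]$. A conformal $\mathcal{R}$-module $V$ is a $\mathbb{C}[\partial]$-module with a $\mathbb{C}$-linear map $\mathcal{R}\otimes V\to V[\lambda]$, $a\otimes v\mapsto a_\lambda v$, satisfying $(\partial a)_\lambda v=-\lambda(a_\lambda v)$, $a_\lambda(\partial v)=(\partial+\lambda)a_\lambda v$, $a_\lambda(b_\mu v)=[a_\lambda b]_{\lambda+\mu}v+b_\mu(a_\lambda v)$. For $\eta\in\mathbb{C}$, $\mathbb{C}c_\eta$ is the one-dimensional module with $\partial c_\eta=\eta c_\eta$ and $\mathcal{R}_\lambda c_\eta=0$. An extension of $W$ by $V$ is an exact sequence of modules $0\to V\to E\to W\to0$. Two extensions $E,E'$ are equivalent if there is a module homomorphism $E\to E'$ compatible with the identity maps of $V$ and $W$. An extension is trivial if it is equivalent to $V\oplus W$. $\mathrm{Ext}(W,V)$ is the vector space of extension cocycles modulo those equivalent to the trivial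 extension, and $\dim\mathrm{Ext}(W,V)$ is its dimension. A solvable rank two Lie conformal algebra (free of rank two over $\mathbb{C}[\partial]$) has a basis $\{A,B\}$, which is fixed, such that $[A_\lambda A]=Q_1(\partial,\lambda)B$, $[A_\lambda B]=p(\lambda)B$, $[B_\lambda B]=0$, where $p(\lambda)$ is a polynomial and $Q_1$ is a skew-symmetric polynomial, i.e. $Q_1(\partial,\lambda)=-Q_1(\partial,-\lambda-\partial)$, with $p(\lambda)Q_1(\partial,\lambda)=0$. Its nontrivial finite irreducible modules are $V_{\phi_A,\phi_B}=\mathbb{C}[\partial]v$ (free of rank one), $A_\lambda v=\phi_A(\lambda)v$, $B_\lambda v=\phi_B(\lambda)v$, where $\phi_A,\phi_B\in\mathbb{C}[\lambda]$ are not both zero, and $\phi_B\neq0$ only if $p=Q_1=0$. *)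

theory Defs
  imports
    Complex_Main
    "HOL-Computational_Algebra.Polynomial"
    "HOL-Library.Function_Algebras"
    "HOL-Library.Product_Plus"
begin

text \<open>
  A \<open>\<complex>[\<partial>]\<close>-module is a library module over the ring of complex polynomials, the polynomial
  variable acting as \<open>\<partial>\<close>; complex scalars act through constant polynomials. The space
  \<open>V[\<lambda>]\<close> is the type of polynomials with coefficients in the abelian group \<open>V\<close>.
\<close>

record 'v dmod =
  smul :: "complex poly \<Rightarrow> 'v \<Rightarrow> 'v"

record (overloaded) 'r lca = "('r::ab_group_add) dmod" +
  bracket :: "'r \<Rightarrow> 'r \<Rightarrow> 'r poly"

record (overloaded) ('v, 'r) cmod = "('v::ab_group_add) dmod" +
  act :: "'r \<Rightarrow> 'v \<Rightarrow> 'v poly"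

abbreviation D :: "('v, 'm) dmod_scheme \<Rightarrow> 'v \<Rightarrow> 'v" where
  "D M \<equiv> smul M [:0, 1:]"

abbreviation scalar :: "('v, 'm) dmod_scheme \<Rightarrow> complex \<Rightarrow> 'v \<Rightarrow> 'v" where
  "scalar M k \<equiv> smul M [:k:]"

text \<open>
  Substitution of \<open>q(\<partial>)\<close> for \<open>\<lambda>\<close> in an element of \<open>V[\<lambda>]\<close>, the powers of \<open>q(\<partial>)\<close> acting on
  the coefficients: \<open>[:l:]\<close> evaluates at \<open>\<lambda> = l\<close>, and \<open>[:- l, - 1:]\<close> puts \<open>- l - \<partial>\<close> for \<open>\<lambda>\<close>.
\<close>

definition subst_lam ::
    "('v::ab_group_add, 'm) dmod_scheme \<Rightarrow> 'v poly \<Rightarrow> complex poly \<Rightarrow> 'v" where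
  "subst_lam M u q = (\<Sum>i\<le>degree u. smul M (q ^ i) (coeff u i))"

abbreviation ev :: "('v::ab_group_add, 'm) dmod_scheme \<Rightarrow> 'v poly \<Rightarrow> complex \<Rightarrow> 'v" where
  "ev M u l \<equiv> subst_lam M u [:l:]"

text \<open>
  The axioms are identities between polynomials in \<open>\<lambda>\<close> (and \<open>\<mu>\<close>) over a complex vector space;
  they are stated at all complex values of the variables, which is the same since
  \<open>\<complex>\<close> is infinite.
\<close>

locale lie_conformal_algebra =
  fixes R :: "('r::ab_group_add) lca"
  assumes module_R: "module (smul R)"
    and bracket_add_left: "bracket R (a + b) c = bracket R a c + bracket R b c"
    and bracket_add_right: "bracket R a (b + c) = bracket R a b + bracket R a c"
    and bracket_scalar_left:
      "bracket R (scalar R k a) b = map_poly (scalar R k) (bracket R a b)"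
    and bracket_scalar_right:
      "bracket R a (scalar R k b) = map_poly (scalar R k) (bracket R a b)"
    and bracket_D_left: "ev R (bracket R (D R a) b) l = smul R [:- l:] (ev R (bracket R a b) l)"
    and bracket_D_right: "ev R (bracket R a (D R b)) l = smul R [:l, 1:] (ev R (bracket R a b) l)"
    and skew: "ev R (bracket R a b) l = - subst_lam R (bracket R b a) [:- l, - 1:]"
    and jacobi:
      "ev R (bracket R a (ev R (bracket R b c) m)) l =
         ev R (bracket R (ev R (bracket R a b) l) c) (l + m) +
         ev R (bracket R b (ev R (bracket R a c) l)) m"

locale conformal_module = lie_conformal_algebra R
  for R :: "('r::ab_group_add) lca" +
  fixes V :: "('v::ab_group_add, 'r) cmod"
  assumes module_V: "module (smul V)"
    and act_add_left: "act V (a + b) x = act V a x + act V b x"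
    and act_add_right: "act V a (x + y) = act V a x + act V a y"
    and act_scalar_left: "act V (scalar R k a) x = map_poly (scalar V k) (act V a x)"
    and act_scalar_right: "act V a (scalar V k x) = map_poly (scalar V k) (act V a x)"
    and act_D_left: "ev V (act V (D R a) x) l = smul V [:- l:] (ev V (act V a x) l)"
    and act_D_right: "ev V (act V a (D V x)) l = smul V [:l, 1:] (ev V (act V a x) l)"
    and act_bracket:
      "ev V (act V a (ev V (act V b x) m)) l =
         ev V (act V (ev R (bracket R a b) l) x) (l + m) +
         ev V (act V b (ev V (act V a x) l)) m"

definition conformal_submodule :: "('v::ab_group_add, 'r) cmod \<Rightarrow> 'v set \<Rightarrow> bool" where
  "conformal_submodule V U \<longleftrightarrow>
     module.subspace (smul V) U \<and> (\<forall>a. \<forall>x\<in>U. \<forall>n. coeff (act V a x) n \<in> U)"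

definition irreducible_module :: "('r::ab_group_add) lca \<Rightarrow> ('v::ab_group_add, 'r) cmod \<Rightarrow> bool" where
  "irreducible_module R V \<longleftrightarrow>
     conformal_module R V \<and> (\<exists>x::'v. x \<noteq> 0) \<and>
     (\<forall>U. conformal_submodule V U \<longrightarrow> U = {0} \<or> U = UNIV)"

definition finite_module :: "('v::ab_group_add, 'r) cmod \<Rightarrow> bool" where
  "finite_module V \<longleftrightarrow> (\<exists>S. finite S \<and> module.span (smul V) S = UNIV)"

definition nontrivial_module :: "('v::ab_group_add, 'r) cmod \<Rightarrow> bool" where
  "nontrivial_module V \<longleftrightarrow> (\<exists>a x. act V a x \<noteq> 0)"

text \<open>The element \<open>\<phi>(\<lambda>) x\<close> of \<open>V[\<lambda>]\<close>.\<close>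

definition poly_times ::
    "('v::ab_group_add, 'm) dmod_scheme \<Rightarrow> complex poly \<Rightarrow> 'v \<Rightarrow> 'v poly" where
  "poly_times M \<phi> x = map_poly (\<lambda>k. scalar M k x) \<phi>"

text \<open>
  A rank two solvable Lie conformal algebra with its fixed basis. The polynomial
  \<open>Q1(\<partial>, \<lambda>)\<close> is a polynomial in \<open>\<lambda>\<close> with coefficients in \<open>\<complex>[\<partial>]\<close>.
\<close>

locale solvable_rank_two = lie_conformal_algebra R
  for R :: "('r::ab_group_add) lca" +
  fixes A B :: 'r and p :: "complex poly" and Q1 :: "complex poly poly"
  assumes basis_distinct: "A \<noteq> B"
    and basis_independent: "\<not> module.dependent (smul R) {A, B}"
    and basis_span: "module.span (smul R) {A, B} = UNIV"
    and bracket_A_A: "bracket R A A = map_poly (\<lambda>q. smul R q B) Q1"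
    and bracket_A_B: "bracket R A B = poly_times R p B"
    and bracket_B_B: "bracket R B B = 0"
    and Q1_skew: "Q1 = - pcompose Q1 [:[:0, - 1:], - 1:]"
    and p_Q1: "map_poly (\<lambda>k. [:k:]) p * Q1 = 0"

text \<open>The module \<open>V\<^bsub>\<phi>A,\<phi>B\<^esub> = \<complex>[\<partial>]v\<close>, free of rank one on \<open>v\<close>.\<close>

definition rank_one_module ::
    "('r::ab_group_add) lca \<Rightarrow> 'r \<Rightarrow> 'r \<Rightarrow> ('v::ab_group_add, 'r) cmod \<Rightarrow> 'v \<Rightarrow>
     complex poly \<Rightarrow> complex poly \<Rightarrow> bool" where
  "rank_one_module R A B V v \<phi>A \<phi>B \<longleftrightarrow>
     conformal_module R V \<and>
     \<not> module.dependent (smul V) {v} \<and> module.span (smul V) {v} = UNIV \<and>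
     act V A v = poly_times V \<phi>A v \<and> act V B v = poly_times V \<phi>B v"

text \<open>The one-dimensional module \<open>\<complex>c\<^bsub>\<eta>\<^esub>\<close> with basis vector \<open>c\<close>.\<close>

definition one_dim_module ::
    "('r::ab_group_add) lca \<Rightarrow> ('c::ab_group_add, 'r) cmod \<Rightarrow> 'c \<Rightarrow> complex \<Rightarrow> bool" where
  "one_dim_module R C c \<eta> \<longleftrightarrow>
     conformal_module R C \<and> c \<noteq> 0 \<and> (\<forall>x. \<exists>k. x = scalar C k c) \<and>
     D C c = scalar C \<eta> c \<and> (\<forall>a. act C a c = 0)"

definition cmod_hom ::
    "('v::ab_group_add, 'r) cmod \<Rightarrow> ('w::ab_group_add, 'r) cmod \<Rightarrow> ('v \<Rightarrow> 'w) \<Rightarrow> bool" where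
  "cmod_hom V W h \<longleftrightarrow>
     module_hom (smul V) (smul W) h \<and> (\<forall>a x. act W a (h x) = map_poly h (act V a x))"

text \<open>The exact sequence \<open>0 \<longrightarrow> V \<longrightarrow> E \<longrightarrow> W \<longrightarrow> 0\<close> with maps \<open>\<iota>\<close> and \<open>\<pi>\<close>.\<close>

definition extension ::
    "('r::ab_group_add) lca \<Rightarrow> ('v::ab_group_add, 'r) cmod \<Rightarrow> ('e::ab_group_add, 'r) cmod \<Rightarrow>
     ('w::ab_group_add, 'r) cmod \<Rightarrow> ('v \<Rightarrow> 'e) \<Rightarrow> ('e \<Rightarrow> 'w) \<Rightarrow> bool" where
  "extension R V E W \<iota> \<pi> \<longleftrightarrow>
     conformal_module R V \<and> conformal_module R E \<and> conformal_module R W \<and>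
     cmod_hom V E \<iota> \<and> cmod_hom E W \<pi> \<and>
     inj \<iota> \<and> range \<iota> = {x. \<pi> x = 0} \<and> surj \<pi>"

definition equivalent_ext ::
    "('e::ab_group_add, 'r) cmod \<Rightarrow> ('v \<Rightarrow> 'e) \<Rightarrow> ('e \<Rightarrow> 'w) \<Rightarrow>
     ('f::ab_group_add, 'r) cmod \<Rightarrow> ('v \<Rightarrow> 'f) \<Rightarrow> ('f \<Rightarrow> 'w) \<Rightarrow> bool" where
  "equivalent_ext E \<iota> \<pi> E' \<iota>' \<pi>' \<longleftrightarrow>
     (\<exists>h. cmod_hom E E' h \<and> h \<circ> \<iota> = \<iota>' \<and> \<pi>' \<circ> h = \<pi>)"

text \<open>
  An extension of \<open>W\<close> by \<open>V\<close> whose underlying complex vector space is \<open>V \<oplus> W\<close> is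
  determined by a pair \<open>(d, \<gamma>)\<close>: \<open>d q w\<close> is the \<open>V\<close>-component of \<open>q(\<partial>) w\<close> and \<open>\<gamma> a w\<close> is the
  \<open>V[\<lambda>]\<close>-component of \<open>a\<^bsub>\<lambda>\<^esub> w\<close>.
\<close>

type_synonym ('v, 'w, 'r) cochain = "(complex poly \<Rightarrow> 'w \<Rightarrow> 'v) \<times> ('r \<Rightarrow> 'w \<Rightarrow> 'v poly)"

definition cochain_module ::
    "('v::ab_group_add, 'r) cmod \<Rightarrow> ('w::ab_group_add, 'r) cmod \<Rightarrow> ('v, 'w, 'r) cochain \<Rightarrow>
     ('v \<times> 'w, 'r) cmod" where
  "cochain_module V W z =
     \<lparr>smul = (\<lambda>q (x, w). (smul V q x + fst z q w, smul W q w)),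
      act = (\<lambda>a (x, w). map_poly (\<lambda>y. (y, 0)) (act V a x + snd z a w) +
                        map_poly (\<lambda>y. (0, y)) (act W a w))\<rparr>"

definition direct_sum ::
    "('v::ab_group_add, 'r) cmod \<Rightarrow> ('w::ab_group_add, 'r) cmod \<Rightarrow> ('v \<times> 'w, 'r) cmod" where
  "direct_sum V W =
     \<lparr>smul = (\<lambda>q (x, w). (smul V q x, smul W q w)),
      act = (\<lambda>a (x, w). map_poly (\<lambda>y. (y, 0)) (act V a x) + map_poly (\<lambda>y. (0, y)) (act W a w))\<rparr>"

definition trivial_ext ::
    "('v::ab_group_add, 'r) cmod \<Rightarrow> ('e::ab_group_add, 'r) cmod \<Rightarrow> ('w::ab_group_add, 'r) cmod \<Rightarrow>
     ('v \<Rightarrow> 'e) \<Rightarrow> ('e \<Rightarrow> 'w) \<Rightarrow> bool" where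
  "trivial_ext V E W \<iota> \<pi> \<longleftrightarrow> equivalent_ext E \<iota> \<pi> (direct_sum V W) (\<lambda>x. (x, 0)) snd"

text \<open>The condition on constant polynomials keeps the scalar multiplication that of \<open>V \<oplus> W\<close>.\<close>

definition cocycles ::
    "('r::ab_group_add) lca \<Rightarrow> ('w::ab_group_add, 'r) cmod \<Rightarrow> ('v::ab_group_add, 'r) cmod \<Rightarrow>
     ('v, 'w, 'r) cochain set" where
  "cocycles R W V =
     {z. (\<forall>k w. fst z [:k:] w = 0) \<and>
         extension R V (cochain_module V W z) W (\<lambda>x. (x, 0)) snd}"

definition trivial_cocycles ::
    "('r::ab_group_add) lca \<Rightarrow> ('w::ab_group_add, 'r) cmod \<Rightarrow> ('v::ab_group_add, 'r) cmod \<Rightarrow>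
     ('v, 'w, 'r) cochain set" where
  "trivial_cocycles R W V =
     {z \<in> cocycles R W V. trivial_ext V (cochain_module V W z) W (\<lambda>x. (x, 0)) snd}"

definition cochain_scale ::
    "('v::ab_group_add, 'r) cmod \<Rightarrow> complex \<Rightarrow> ('v, 'w, 'r) cochain \<Rightarrow> ('v, 'w, 'r) cochain" where
  "cochain_scale V k z =
     (\<lambda>q w. scalar V k (fst z q w), \<lambda>a w. map_poly (scalar V k) (snd z a w))"

text \<open>
  \<open>dim Z/N = n\<close>: the classes of some \<open>z 0, \<dots>, z (n - 1)\<close> in \<open>Z\<close> form a basis of \<open>Z/N\<close>. (A relation,
  because the library dimension is \<open>0\<close> on infinite-dimensional spaces.)
\<close>

definition quotient_has_dim ::
    "(complex \<Rightarrow> 'x \<Rightarrow> 'x) \<Rightarrow> ('x::ab_group_add) set \<Rightarrow> 'x set \<Rightarrow> nat \<Rightarrow> bool" where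
  "quotient_has_dim sc Z N n \<longleftrightarrow>
     (\<exists>z. (\<forall>i<n. z i \<in> Z) \<and>
       (\<forall>x\<in>Z. \<exists>!k. (\<forall>i\<ge>n. k i = 0) \<and> x - (\<Sum>i<n. sc (k i) (z i)) \<in> N))"

text \<open>\<open>dim Ext(W, V) = n\<close>.\<close>

definition Ext_has_dim ::
    "('r::ab_group_add) lca \<Rightarrow> ('w::ab_group_add, 'r) cmod \<Rightarrow> ('v::ab_group_add, 'r) cmod \<Rightarrow>
     nat \<Rightarrow> bool" where
  "Ext_has_dim R W V n \<longleftrightarrow>
     quotient_has_dim (cochain_scale V) (cocycles R W V) (trivial_cocycles R W V) n"

text \<open>
  The presentation of an extension \<open>E\<close> of \<open>V\<^bsub>\<phi>A,\<phi>B\<^esub> = \<complex>[\<partial>]v\<close> by \<open>\<complex>c\<^bsub>\<eta>\<^esub>\<close> by polynomials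
  \<open>f, g\<close>: here \<open>c'\<close> is the image of \<open>c\<close> in \<open>E\<close> and \<open>v'\<close> is a lift of \<open>v\<close> to \<open>E\<close>.
\<close>

definition presented_by ::
    "'r \<Rightarrow> 'r \<Rightarrow> 'c \<Rightarrow> complex \<Rightarrow> 'v \<Rightarrow> complex poly \<Rightarrow> complex poly \<Rightarrow>
     ('e::ab_group_add, 'r) cmod \<Rightarrow> ('c \<Rightarrow> 'e) \<Rightarrow> ('e \<Rightarrow> 'v) \<Rightarrow>
     complex poly \<Rightarrow> complex poly \<Rightarrow> bool" where
  "presented_by A B c \<eta> v \<phi>A \<phi>B E \<iota> \<pi> f g \<longleftrightarrow>
     (\<exists>c' v'. c' = \<iota> c \<and> \<pi> v' = v \<and>
        (\<forall>x. \<exists>!(k, q). x = scalar E k c' + smul E q v') \<and>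
        (\<forall>a. act E a c' = 0) \<and> D E c' = scalar E \<eta> c' \<and>
        act E A v' = poly_times E \<phi>A v' + poly_times E f c' \<and>
        act E B v' = poly_times E \<phi>B v' + poly_times E g c')"

end

theory Submission
  imports Defs
begin

text \<open>
  Let \<open>E\<close> be an extension and \<open>v'\<close> a lift of \<open>v\<close>. As \<open>V\<close> is free over \<open>\<complex>[\<partial>]\<close>, we have
  \<open>E = \<complex>c \<oplus> \<complex>[\<partial>]v'\<close>, and the action on \<open>v'\<close> is that on \<open>v\<close> up to multiples \<open>f(\<lambda>) c\<close> and \<open>g(\<lambda>) c\<close>. The
  module axiom for \<open>A\<close> and \<open>B\<close>, evaluated at \<open>v'\<close>, gives three functional equations
  (\<open>lift_action_relations\<close>):
  \<open>\<phi>A(\<mu>) f(\<lambda>) = Q\<^sub>1(- \<lambda> - \<mu>, \<lambda>) g(\<lambda> + \<mu>) + \<phi>A(\<lambda>) f(\<mu>)\<close>,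
  \<open>\<phi>B(\<mu>) f(\<lambda>) = p(\<lambda>) g(\<lambda> + \<mu>) + \<phi>A(\<lambda>) g(\<mu>)\<close> and \<open>\<phi>B(\<mu>) g(\<lambda>) = \<phi>B(\<lambda>) g(\<mu>)\<close>.
  Replacing \<open>v'\<close> by \<open>v' + k c\<close> subtracts \<open>k (\<phi>A, \<phi>B)\<close> from \<open>(f, g)\<close>, so an extension is trivial as soon
  as \<open>(f, g)\<close> is a multiple of \<open>(\<phi>A, \<phi>B)\<close>. For \<open>p = 0\<close> the equations force this. For \<open>p \<noteq> 0\<close> we have
  \<open>Q\<^sub>1 = 0\<close> and \<open>\<phi>B = 0\<close>; the first equation makes \<open>f\<close> a multiple of \<open>\<phi>A\<close>, hence removable, and the
  second becomes \<open>p(\<lambda>) g(\<lambda> + \<mu>) + \<phi>A(\<lambda>) g(\<mu>) = 0\<close>. If \<open>g \<noteq> 0\<close>, leading coefficients in \<open>\<mu>\<close> give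
  \<open>\<phi>A = - p\<close>, and then \<open>g\<close> is constant (\<open>lift_normal_form\<close>).

  Conversely, for \<open>p \<noteq> 0\<close> and \<open>\<phi>A = - p\<close> every constant \<open>g = k\<close> does come from an extension, written down as a split
  cochain (\<open>conformal_module_std_cochain\<close>). It is not trivial for \<open>k \<noteq> 0\<close>, because \<open>B\<close> annihilates
  \<open>C \<oplus> V\<close> but not \<open>v'\<close> (\<open>not_trivial\<close>).

  For the dimension, cocycles with equivalent extensions differ by the coboundary of a linear map \<open>\<tau>\<close>,
  and every coboundary is a trivial cocycle (\<open>trivial_cocycles_eq_coboundaries\<close>). The class of
  the cocycle with \<open>k = 1\<close> is then a basis of \<open>Ext\<close>.

  Throughout, elements of \<open>V[\<lambda>]\<close> are compared through their values at complex numbers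
  (\<open>ev_inject\<close>), which lets the axioms be used in the form in which they are stated.
\<close>

section \<open>Evaluation of elements of \<open>V[\<lambda>]\<close>\<close>

lemma coeff_poly_times:
  assumes "module (smul M)"
  shows "coeff (poly_times M \<phi> x) n = scalar M (coeff \<phi> n) x"
  using assms by (simp add: poly_times_def coeff_map_poly module.scale_zero_left)

lemma poly_times_0: "poly_times M 0 x = 0"
  by (simp add: poly_times_def)

lemma poly_times_add:
  assumes "module (smul M)"
  shows "poly_times M (\<phi> + \<psi>) x = poly_times M \<phi> x + poly_times M \<psi> x"
proof (rule poly_eqI)
  interpret module "smul M" by (rule assms)
  show "coeff (poly_times M (\<phi> + \<psi>) x) n = coeff (poly_times M \<phi> x + poly_times M \<psi> x) n" for n
    using scale_left_distrib[of "[:coeff \<phi> n:]" "[:coeff \<psi> n:]" x]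
    by (simp add: coeff_poly_times assms)
qed

lemma poly_times_minus:
  assumes "module (smul M)"
  shows "poly_times M (- \<phi>) x = - poly_times M \<phi> x"
  using poly_times_add[OF assms, of "- \<phi>" \<phi> x]
  by (simp add: poly_times_0 eq_neg_iff_add_eq_0)

lemma poly_times_vector_add:
  assumes "module (smul M)"
  shows "poly_times M \<phi> (x + y) = poly_times M \<phi> x + poly_times M \<phi> y"
proof (rule poly_eqI)
  interpret module "smul M" by (rule assms)
  show "coeff (poly_times M \<phi> (x + y)) n = coeff (poly_times M \<phi> x + poly_times M \<phi> y) n" for n
    by (simp add: coeff_poly_times assms scale_right_distrib)
qed

lemma poly_times_scalar:
  assumes "module (smul M)"
  shows "poly_times M \<phi> (scalar M k x) = poly_times M (smult k \<phi>) x"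
    and "map_poly (scalar M k) (poly_times M \<phi> x) = poly_times M (smult k \<phi>) x"
proof -
  interpret module "smul M" by (rule assms)
  show "poly_times M \<phi> (scalar M k x) = poly_times M (smult k \<phi>) x"
    by (rule poly_eqI) (simp add: coeff_poly_times assms scale_left_commute mult.commute)
  show "map_poly (scalar M k) (poly_times M \<phi> x) = poly_times M (smult k \<phi>) x"
    by (rule poly_eqI) (simp add: coeff_poly_times assms coeff_map_poly mult.commute)
qed

lemma map_poly_poly_times:
  assumes "module_hom (smul M) (smul N) h"
  shows "map_poly h (poly_times M \<phi> x) = poly_times N \<phi> (h x)"
proof -
  interpret module_hom "smul M" "smul N" h by (rule assms)
  show ?thesis
    by (rule poly_eqI)
      (simp add: coeff_poly_times m1.module_axioms m2.module_axioms coeff_map_poly scale)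
qed

lemma map_poly_additive:
  fixes h :: "'a::ab_group_add \<Rightarrow> 'b::ab_group_add"
  assumes "\<And>x y. h (x + y) = h x + h y"
  shows "map_poly h (u + u') = map_poly h u + map_poly h u'"
proof -
  interpret additive h by unfold_locales (rule assms)
  show ?thesis by (rule poly_eqI) (simp add: coeff_map_poly zero add)
qed

lemma subst_lam_bound:
  assumes "module (smul M)" and "degree u \<le> N"
  shows "subst_lam M u q = (\<Sum>i\<le>N. smul M (q ^ i) (coeff u i))"
proof -
  interpret module "smul M" by (rule assms)
  show ?thesis unfolding subst_lam_def
    by (rule sum.mono_neutral_left) (use assms(2) in \<open>auto simp: coeff_eq_0\<close>)
qed

lemma subst_lam_0:
  assumes "module (smul M)"
  shows "subst_lam M 0 q = 0"
  using assms by (simp add: subst_lam_def module.scale_zero_right)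

lemma subst_lam_add:
  assumes "module (smul M)"
  shows "subst_lam M (u + w) q = subst_lam M u q + subst_lam M w q"
proof -
  interpret module "smul M" by (rule assms)
  define N where "N = max (degree u) (degree w)"
  have "degree u \<le> N" "degree w \<le> N" "degree (u + w) \<le> N"
    by (auto simp: N_def degree_add_le)
  then show ?thesis
    by (simp add: subst_lam_bound[OF assms] scale_right_distrib sum.distrib)
qed

lemma subst_lam_map_poly:
  assumes M: "module (smul M)" and N: "module (smul N)"
    and add: "\<And>x y. h (x + y) = h x + h y"
    and scale: "\<And>q x. h (smul M q x) = smul N q (h x)"
  shows "h (subst_lam M u q) = subst_lam N (map_poly h u) q"
proof -
  interpret module_hom "smul M" "smul N" h
    using M N add scale by (simp add: module_hom_iff)
  have "h (subst_lam M u q) = (\<Sum>i\<le>degree u. smul N (q ^ i) (coeff (map_poly h u) i))"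
    by (simp add: subst_lam_def sum scale coeff_map_poly)
  then show ?thesis
    by (simp add: subst_lam_bound[OF N, of "map_poly h u" "degree u"] map_poly_degree_leq)
qed

lemma subst_lam_scalar:
  assumes "module (smul M)"
  shows "subst_lam M (map_poly (smul M r) u) q = smul M r (subst_lam M u q)"
proof -
  interpret module "smul M" by (rule assms)
  show ?thesis
    by (rule subst_lam_map_poly[symmetric, OF assms assms])
      (simp_all add: scale_right_distrib mult.commute)
qed

lemma subst_lam_map_smul:
  assumes "module (smul M)"
  shows "subst_lam M (map_poly (\<lambda>q. smul M q x) Q) r = smul M (poly Q r) x"
proof -
  interpret module "smul M" by (rule assms)
  have "subst_lam M (map_poly (\<lambda>q. smul M q x) Q) r
      = (\<Sum>i\<le>degree Q. smul M (r ^ i) (smul M (coeff Q i) x))"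
    by (simp add: subst_lam_bound[OF assms, of _ "degree Q"] map_poly_degree_leq coeff_map_poly)
  also have "\<dots> = smul M (poly Q r) x"
    by (simp add: poly_altdef scale_sum_left mult.commute)
  finally show ?thesis .
qed

lemma subst_lam_poly_times:
  assumes "module (smul M)"
  shows "subst_lam M (poly_times M \<phi> x) q = smul M (pcompose \<phi> q) x"
proof -
  have "poly_times M \<phi> x = map_poly (\<lambda>q. smul M q x) (map_poly (\<lambda>k. [:k:]) \<phi>)"
    by (simp add: poly_times_def map_poly_map_poly o_def assms module.scale_zero_left)
  then show ?thesis
    by (simp add: subst_lam_map_smul[OF assms] pcompose_altdef)
qed

lemma ev_poly_times:
  assumes "module (smul M)"
  shows "ev M (poly_times M \<phi> x) l = scalar M (poly \<phi> l) x"
  by (simp add: subst_lam_poly_times[OF assms] pcompose_pCons_0)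

text \<open>
  A polynomial in \<open>\<lambda>\<close> over a complex vector space that vanishes at every complex number is
  zero, although no basis of the vector space is at hand: \<open>u(2 \<lambda>) - 2\<^sup>n u(\<lambda>)\<close> loses the term of
  degree \<open>n\<close> and multiplies the lower ones by nonzero scalars, so that induction on the degree
  applies.
\<close>

lemma vanishing_scalar_combination:
  assumes "module (smul M)"
    and "\<And>l::complex. (\<Sum>i<n. smul M [:l ^ i:] (x i)) = 0" and "i < n"
  shows "x i = 0"
  using assms(2,3)
proof (induction n arbitrary: x i)
  case 0
  then show ?case by simp
next
  case (Suc n)
  interpret module "smul M" by (rule assms)
  \<comment> \<open>The terms below the top one vanish by the induction hypothesis for \<open>u(2 \<lambda>) - 2\<^sup>n u(\<lambda>)\<close>.\<close>
  have low: "x j = 0" if "j < n" for j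
  proof -
    have "(\<Sum>i<n. smul M [:l ^ i:] (smul M [:2 ^ i - 2 ^ n:] (x i))) = 0" for l :: complex
    proof -
      have "smul M [:l ^ i:] (smul M [:2 ^ i - 2 ^ n:] y)
          = smul M [:(2 * l) ^ i:] y - smul M [:2 ^ n:] (smul M [:l ^ i:] y)" for i y
      proof -
        have "[:l ^ i:] * [:2 ^ i - 2 ^ n:] = [:(2 * l) ^ i:] - [:2 ^ n:] * [:l ^ i:]"
          by (simp add: power_mult_distrib right_diff_distrib mult.commute)
        then show ?thesis
          by (simp only: scale_scale scale_left_diff_distrib)
      qed
      then have "(\<Sum>i<Suc n. smul M [:l ^ i:] (smul M [:2 ^ i - 2 ^ n:] (x i)))
          = (\<Sum>i<Suc n. smul M [:(2 * l) ^ i:] (x i))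
            - smul M [:2 ^ n:] (\<Sum>i<Suc n. smul M [:l ^ i:] (x i))"
        by (simp only: scale_sum_right sum_subtractf)
      then show ?thesis
        by (simp only: Suc.prems(1) scale_zero_right diff_self) simp
    qed
    from Suc.IH[OF this that] have "smul M [:2 ^ j - 2 ^ n:] (x j) = 0" .
    then have "smul M [:inverse (2 ^ j - 2 ^ n):] (smul M [:2 ^ j - 2 ^ n:] (x j)) = 0"
      by simp
    moreover have "(2::complex) ^ j \<noteq> 2 ^ n"
    proof
      assume "(2::complex) ^ j = 2 ^ n"
      then have "of_nat (2 ^ j) = (of_nat (2 ^ n) :: complex)" by simp
      then have "(2::nat) ^ j = 2 ^ n" by (simp only: of_nat_eq_iff)
      with that show False by simp
    qed
    ultimately show ?thesis
      by (simp add: one_pCons[symmetric])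
  qed
  from Suc.prems(1)[of 1] low have "x n = 0"
    by (simp add: one_pCons[symmetric])
  with low Suc.prems(2) show ?case by (auto simp: less_Suc_eq)
qed

lemma ev_inject:
  assumes "module (smul M)" and "\<And>l. ev M u l = ev M w l"
  shows "u = w"
proof (rule poly_eqI)
  fix i
  interpret module "smul M" by (rule assms)
  define N where "N = max i (max (degree u) (degree w))"
  have "degree u \<le> N" "degree w \<le> N" and i: "i < Suc N"
    by (auto simp: N_def)
  note bound = this(1,2)[THEN subst_lam_bound[OF assms(1)]]
  have "(\<Sum>j<Suc N. smul M [:l ^ j:] (coeff u j - coeff w j)) = 0" for l
    using assms(2)[of l]
    by (simp only: bound poly_const_pow scale_right_diff_distrib sum_subtractf
        lessThan_Suc_atMost diff_self)
  from vanishing_scalar_combination[OF assms(1) this i] show "coeff u i = coeff w i"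
    by simp
qed

section \<open>Conformal modules and their homomorphisms\<close>

text \<open>A Lie conformal algebra is a module over itself, which gives the formulas below for brackets.\<close>

lemma (in lie_conformal_algebra) conformal_module_adjoint:
  "conformal_module R \<lparr>smul = smul R, act = bracket R\<rparr>"
proof -
  have ev: "subst_lam \<lparr>smul = smul R, act = bracket R\<rparr> = subst_lam R"
    by (simp add: subst_lam_def fun_eq_iff)
  show ?thesis
    by (intro conformal_module.intro conformal_module_axioms.intro lie_conformal_algebra_axioms)
      (simp_all add: ev module_R bracket_add_left bracket_add_right bracket_scalar_left
        bracket_scalar_right bracket_D_left bracket_D_right, rule jacobi)
qed

context conformal_module
begin

sublocale mod_R: module "smul R" by (rule module_R)
sublocale mod_V: module "smul V" by (rule module_V)

lemma act_0_left: "act V 0 x = 0"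
  using act_add_left[of 0 0 x] by simp

lemma act_0_right: "act V a 0 = 0"
  using act_add_right[of a 0 0] by simp

lemma ev_act_add_left: "ev V (act V (a + b) x) l = ev V (act V a x) l + ev V (act V b x) l"
  by (simp add: act_add_left subst_lam_add module_V)

lemma ev_act_add_right: "ev V (act V a (x + y)) l = ev V (act V a x) l + ev V (act V a y) l"
  by (simp add: act_add_right subst_lam_add module_V)

lemma ev_act_smul_left: "ev V (act V (smul R q a) x) l = scalar V (poly q (- l)) (ev V (act V a x) l)"
proof (induction q)
  case 0
  then show ?case by (simp add: act_0_left subst_lam_0 module_V)
next
  case (pCons k q)
  have "pCons k q = [:k:] + [:0, 1:] * q" by simp
  then have eq: "smul R (pCons k q) a = scalar R k a + D R (smul R q a)"
    by (simp only: mod_R.scale_left_distrib mod_R.scale_scale)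
  show ?case
    unfolding eq ev_act_add_left act_scalar_left act_D_left subst_lam_scalar[OF module_V] pCons.IH
      mod_V.scale_scale mod_V.scale_left_distrib[symmetric]
    by (simp add: mult.commute)
qed

lemma ev_act_smul_right:
  "ev V (act V a (smul V q x)) l = smul V (pcompose q [:l, 1:]) (ev V (act V a x) l)"
proof (induction q)
  case 0
  then show ?case by (simp add: act_0_right subst_lam_0 module_V)
next
  case (pCons k q)
  have "pCons k q = [:k:] + [:0, 1:] * q" by simp
  then have eq: "smul V (pCons k q) x = scalar V k x + D V (smul V q x)"
    by (simp only: mod_V.scale_left_distrib mod_V.scale_scale)
  show ?case
    unfolding eq ev_act_add_right act_scalar_right act_D_right subst_lam_scalar[OF module_V] pCons.IH
    unfolding mod_V.scale_scale mod_V.scale_left_distrib[symmetric]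
    by (simp add: pcompose_pCons)
qed

end

text \<open>
  Sesquilinearity determines both sides of \<open>h (a\<^bsub>\<lambda>\<^esub> x) = a\<^bsub>\<lambda>\<^esub> h x\<close> from generators over \<open>\<complex>[\<partial>]\<close>, so it
  is enough to compare them there.
\<close>

lemma cmod_hom_of_generators:
  assumes X: "conformal_module R X" and Y: "conformal_module R Y"
    and h: "module_hom (smul X) (smul Y) h"
    and G: "module.span (smul R) G = UNIV" and S: "module.span (smul X) S = UNIV"
    and gen: "\<And>a x. a \<in> G \<Longrightarrow> x \<in> S \<Longrightarrow> act Y a (h x) = map_poly h (act X a x)"
  shows "cmod_hom X Y h"
proof -
  interpret X: conformal_module R X by (rule X)
  interpret Y: conformal_module R Y by (rule Y)
  interpret h: module_hom "smul X" "smul Y" h by (rule h)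
  have ev_h: "h (ev X u l) = ev Y (map_poly h u) l" for u l
    by (rule subst_lam_map_poly[OF X.module_V Y.module_V h.add h.scale])
  have right: "ev Y (act Y a (h x)) l = h (ev X (act X a x) l)" if "a \<in> G" for a x l
  proof -
    have "x \<in> module.span (smul X) S" by (simp add: S)
    then show ?thesis
    proof (induction rule: X.mod_V.span_induct_alt)
      case base
      then show ?case
        by (simp add: X.act_0_right Y.act_0_right subst_lam_0 X.module_V Y.module_V)
    next
      case (step q y z)
      then show ?case
        by (simp add: h.add h.scale X.ev_act_add_right Y.ev_act_add_right X.ev_act_smul_right
            Y.ev_act_smul_right gen[OF that] ev_h)
    qed
  qed
  have "ev Y (act Y a (h x)) l = h (ev X (act X a x) l)" for a x l
  proof -
    have "a \<in> module.span (smul R) G" by (simp add: G)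
    then show ?thesis
    proof (induction rule: X.mod_R.span_induct_alt)
      case base
      then show ?case
        by (simp add: X.act_0_left Y.act_0_left subst_lam_0 X.module_V Y.module_V)
    next
      case (step q y z)
      then show ?case
        by (simp add: h.add h.scale X.ev_act_add_left Y.ev_act_add_left X.ev_act_smul_left
            Y.ev_act_smul_left right)
    qed
  qed
  then have "act Y a (h x) = map_poly h (act X a x)" for a x
    by (intro ev_inject[OF Y.module_V]) (simp add: ev_h)
  with h show ?thesis by (simp add: cmod_hom_def)
qed

text \<open>
  The axioms are identities, so they pass to a structure embedded in a conformal module. This
  spares checking them for a module that is given only as a twisted form of a known one.
\<close>

lemma conformal_module_transport:
  fixes h :: "'e::ab_group_add \<Rightarrow> 'f::ab_group_add"
  assumes F: "conformal_module R F" and inj: "inj h"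
    and add: "\<And>x y. h (x + y) = h x + h y"
    and scale: "\<And>q x. h (smul E q x) = smul F q (h x)"
    and act: "\<And>a x. map_poly h (act E a x) = act F a (h x)"
  shows "conformal_module R E"
proof -
  interpret F: conformal_module R F by (rule F)
  interpret additive h by unfold_locales (rule add)
  have modE: "module (smul E)"
    by unfold_locales
      (simp_all add: inj_eq[OF inj, symmetric] add scale F.mod_V.scale_right_distrib
        F.mod_V.scale_left_distrib)
  have ev_h: "h (subst_lam E u q) = subst_lam F (map_poly h u) q" for u q
    by (rule subst_lam_map_poly[OF modE F.module_V add scale])
  have map_eq: "u = w" if "map_poly h u = map_poly h w" for u w
    using that by (simp add: poly_eq_iff coeff_map_poly zero inj_eq[OF inj])
  have scalar: "map_poly h (map_poly (scalar E k) u) = map_poly (scalar F k) (map_poly h u)" for k u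
    by (simp add: poly_eq_iff coeff_map_poly zero modE module.scale_zero_right scale)
  show ?thesis
  proof (intro conformal_module.intro conformal_module_axioms.intro F.lie_conformal_algebra_axioms)
    show "module (smul E)" by (rule modE)
    show "act E (a + b) x = act E a x + act E b x" for a b x
      by (rule map_eq) (simp add: map_poly_additive add act F.act_add_left)
    show "act E a (x + y) = act E a x + act E a y" for a x y
      by (rule map_eq) (simp add: map_poly_additive add act F.act_add_right)
    show "act E (scalar R k a) x = map_poly (scalar E k) (act E a x)" for k a x
      by (rule map_eq) (simp add: scalar act F.act_scalar_left)
    show "act E a (scalar E k x) = map_poly (scalar E k) (act E a x)" for k a x
      by (rule map_eq) (simp add: scalar act scale F.act_scalar_right)
    show "ev E (act E (D R a) x) l = smul E [:- l:] (ev E (act E a x) l)" for a x l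
      by (rule injD[OF inj]) (simp add: ev_h scale act F.act_D_left)
    show "ev E (act E a (D E x)) l = smul E [:l, 1:] (ev E (act E a x) l)" for a x l
      by (rule injD[OF inj]) (simp add: ev_h scale act F.act_D_right)
    show "ev E (act E a (ev E (act E b x) m)) l =
        ev E (act E (ev R (bracket R a b) l) x) (l + m) +
        ev E (act E b (ev E (act E a x) l)) m" for a b x l m
      by (rule injD[OF inj]) (simp only: ev_h add act, rule F.act_bracket)
  qed
qed

section \<open>Extensions given by cochains\<close>

lemma smul_cochain_module [simp]:
  "smul (cochain_module V W z) q (x, w) = (smul V q x + fst z q w, smul W q w)"
  by (simp add: cochain_module_def)

lemma coeff_act_cochain_module [simp]:
  "coeff (act (cochain_module V W z) a (x, w)) n
     = (coeff (act V a x + snd z a w) n, coeff (act W a w) n)"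
  by (simp add: cochain_module_def coeff_map_poly zero_prod_def)

lemma direct_sum_eq_cochain_module: "direct_sum V W = cochain_module V W 0"
  by (simp add: direct_sum_def cochain_module_def)

lemma module_split_cochain:
  assumes "module (smul V)" and "module (smul W)"
  shows "module (smul (cochain_module V W (\<lambda>q w. 0, \<gamma>)))"
proof -
  interpret V: module "smul V" by (rule assms)
  interpret W: module "smul W" by (rule assms)
  show ?thesis
    by unfold_locales
      (auto simp: V.scale_right_distrib W.scale_right_distrib V.scale_left_distrib
        W.scale_left_distrib)
qed

text \<open>
  If the sequence splits over \<open>\<complex>[\<partial>]\<close>, the only data left is the bilinear map \<open>\<gamma>\<close>, and the
  module axioms for the extension say that \<open>\<gamma>\<close> is sesquilinear and a one-cocycle.
\<close>

lemma conformal_module_split_cochain: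
  assumes V: "conformal_module R V" and W: "conformal_module R W"
    and add_left: "\<And>a b w. \<gamma> (a + b) w = \<gamma> a w + \<gamma> b w"
    and add_right: "\<And>a w w'. \<gamma> a (w + w') = \<gamma> a w + \<gamma> a w'"
    and scalar_left: "\<And>k a w. \<gamma> (scalar R k a) w = map_poly (scalar V k) (\<gamma> a w)"
    and scalar_right: "\<And>k a w. \<gamma> a (scalar W k w) = map_poly (scalar V k) (\<gamma> a w)"
    and D_left: "\<And>a w l. ev V (\<gamma> (D R a) w) l = smul V [:- l:] (ev V (\<gamma> a w) l)"
    and D_right: "\<And>a w l. ev V (\<gamma> a (D W w)) l = smul V [:l, 1:] (ev V (\<gamma> a w) l)"
    and cocycle: "\<And>a b w l m.
      ev V (act V a (ev V (\<gamma> b w) m)) l + ev V (\<gamma> a (ev W (act W b w) m)) l =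
      ev V (\<gamma> (ev R (bracket R a b) l) w) (l + m) +
      (ev V (act V b (ev V (\<gamma> a w) l)) m + ev V (\<gamma> b (ev W (act W a w) l)) m)"
  shows "conformal_module R (cochain_module V W (\<lambda>q w. 0, \<gamma>))" (is "conformal_module R ?E")
proof -
  interpret V: conformal_module R V by (rule V)
  interpret W: conformal_module R W by (rule W)
  have modE: "module (smul ?E)"
    by (rule module_split_cochain) (rule V.module_V, rule W.module_V)
  have ev_E: "subst_lam ?E (act ?E a (x, w)) q =
      (subst_lam V (act V a x) q + subst_lam V (\<gamma> a w) q, subst_lam W (act W a w) q)" for a x w q
  proof (rule prod_eqI)
    have "map_poly fst (act ?E a (x, w)) = act V a x + \<gamma> a w"
      by (simp add: poly_eq_iff coeff_map_poly)
    then show "fst (subst_lam ?E (act ?E a (x, w)) q) =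
        fst (subst_lam V (act V a x) q + subst_lam V (\<gamma> a w) q, subst_lam W (act W a w) q)"
      by (subst subst_lam_map_poly[OF modE V.module_V]) (auto simp: subst_lam_add V.module_V)
    have "map_poly snd (act ?E a (x, w)) = act W a w"
      by (simp add: poly_eq_iff coeff_map_poly)
    then show "snd (subst_lam ?E (act ?E a (x, w)) q) =
        snd (subst_lam V (act V a x) q + subst_lam V (\<gamma> a w) q, subst_lam W (act W a w) q)"
      by (subst subst_lam_map_poly[OF modE W.module_V]) auto
  qed
  show ?thesis
  proof (intro conformal_module.intro conformal_module_axioms.intro V.lie_conformal_algebra_axioms)
    show "module (smul ?E)" by (rule modE)
    show "act ?E (a + b) x = act ?E a x + act ?E b x" for a b x
      by (cases x) (simp add: poly_eq_iff V.act_add_left W.act_add_left add_left)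
    show "act ?E a (x + y) = act ?E a x + act ?E a y" for a x y
      by (cases x; cases y) (simp add: poly_eq_iff V.act_add_right W.act_add_right add_right)
    show "act ?E (scalar R k a) x = map_poly (scalar ?E k) (act ?E a x)" for k a x
      by (cases x)
        (simp add: poly_eq_iff coeff_map_poly modE module.scale_zero_right V.act_scalar_left
          W.act_scalar_left scalar_left V.mod_V.scale_right_distrib)
    show "act ?E a (scalar ?E k x) = map_poly (scalar ?E k) (act ?E a x)" for k a x
      by (cases x)
        (simp add: poly_eq_iff coeff_map_poly modE module.scale_zero_right V.act_scalar_right
          W.act_scalar_right scalar_right V.mod_V.scale_right_distrib)
    show "ev ?E (act ?E (D R a) x) l = smul ?E [:- l:] (ev ?E (act ?E a x) l)" for a x l
      by (cases x)
        (simp add: ev_E V.act_D_left W.act_D_left D_left V.mod_V.scale_right_distrib)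
    show "ev ?E (act ?E a (D ?E x)) l = smul ?E [:l, 1:] (ev ?E (act ?E a x) l)" for a x l
      by (cases x)
        (simp add: ev_E V.act_D_right W.act_D_right D_right V.mod_V.scale_right_distrib)
    show "ev ?E (act ?E a (ev ?E (act ?E b x) m)) l =
        ev ?E (act ?E (ev R (bracket R a b) l) x) (l + m) +
        ev ?E (act ?E b (ev ?E (act ?E a x) l)) m" for a b x l m
    proof (cases x)
      case (Pair y w)
      show ?thesis
        using cocycle[of a b w m l] V.act_bracket[of a b y m l] W.act_bracket[of a b w m l]
        by (simp add: Pair ev_E V.ev_act_add_right algebra_simps)
    qed
  qed
qed

lemma conformal_module_direct_sum:
  assumes "conformal_module R V" and "conformal_module R W"
  shows "conformal_module R (direct_sum V W)"
proof -
  interpret V: conformal_module R V by (rule assms)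
  have "conformal_module R (cochain_module V W (\<lambda>q w. 0, \<lambda>a w. 0))"
    by (rule conformal_module_split_cochain[OF assms])
      (simp_all add: subst_lam_0 V.module_V V.act_0_right)
  then show ?thesis
    by (simp add: direct_sum_eq_cochain_module zero_prod_def zero_fun_def)
qed

lemma extension_cochain_module:
  fixes V :: "('v::ab_group_add, 'r::ab_group_add) cmod" and W :: "('w::ab_group_add, 'r) cmod"
  assumes V: "conformal_module R V" and W: "conformal_module R W"
    and E: "conformal_module R (cochain_module V W z)" (is "conformal_module R ?E")
  shows "extension R V (cochain_module V W z) W (\<lambda>x. (x, 0)) snd"
proof -
  interpret V: conformal_module R V by (rule V)
  interpret W: conformal_module R W by (rule W)
  interpret E: conformal_module R ?E by (rule E)
  have d0: "fst z q 0 = 0" for q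
    using E.mod_V.scale_zero_right[of q] by (simp add: zero_prod_def)
  have \<gamma>0: "snd z a 0 = 0" for a
    using E.act_0_right[of a] coeff_act_cochain_module[of V W z a 0 0]
    by (simp add: zero_prod_def poly_eq_iff V.act_0_right)
  have "cmod_hom V ?E (\<lambda>x. (x, 0))"
    by (auto simp: cmod_hom_def module_hom_iff V.module_V E.module_V d0 \<gamma>0 poly_eq_iff
        coeff_map_poly zero_prod_def W.act_0_right)
  moreover have "cmod_hom ?E W snd"
    by (auto simp: cmod_hom_def module_hom_iff W.module_V E.module_V poly_eq_iff coeff_map_poly)
  moreover have "range (\<lambda>x. (x, 0)) = {x :: 'v \<times> 'w. snd x = 0}"
    by (auto simp: image_iff)
  moreover have "inj (\<lambda>x::'v. (x, 0::'w))" by (rule injI) simp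
  ultimately show ?thesis
    by (simp add: extension_def V W E)
qed

section \<open>Equivalent cochains differ by a coboundary\<close>

definition coboundary ::
    "('v::ab_group_add, 'r) cmod \<Rightarrow> ('w::ab_group_add, 'r) cmod \<Rightarrow> ('w \<Rightarrow> 'v) \<Rightarrow>
     ('v, 'w, 'r) cochain" where
  "coboundary V W \<tau> =
     (\<lambda>q w. smul V q (\<tau> w) - \<tau> (smul W q w), \<lambda>a w. act V a (\<tau> w) - map_poly \<tau> (act W a w))"

definition scalar_linear ::
    "('w::ab_group_add, 'm) dmod_scheme \<Rightarrow> ('v::ab_group_add, 'n) dmod_scheme \<Rightarrow> ('w \<Rightarrow> 'v) \<Rightarrow> bool"
  where "scalar_linear W V \<tau> \<longleftrightarrow>
    (\<forall>x y. \<tau> (x + y) = \<tau> x + \<tau> y) \<and> (\<forall>k x. \<tau> (scalar W k x) = scalar V k (\<tau> x))"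

text \<open>
  An equivalence that is the identity on the submodule and on the quotient has the form
  \<open>(x, w) \<mapsto> (x + \<tau> w, w)\<close>; comparing the two structures along it gives the coboundary of \<open>\<tau>\<close>.
\<close>

lemma coboundary_of_equivalence:
  assumes V: "conformal_module R V"
    and equiv: "equivalent_ext (cochain_module V W z) (\<lambda>x. (x, 0)) snd
        (cochain_module V W z') (\<lambda>x. (x, 0)) snd"
    and const: "\<And>k w. fst z [:k:] w = 0" "\<And>k w. fst z' [:k:] w = 0"
  shows "\<exists>\<tau>. scalar_linear W V \<tau> \<and> z - z' = coboundary V W \<tau>"
proof -
  let ?E = "cochain_module V W z" and ?E' = "cochain_module V W z'"
  interpret V: conformal_module R V by (rule V)
  obtain h where hom: "cmod_hom ?E ?E' h" and h\<iota>: "h \<circ> (\<lambda>x. (x, 0)) = (\<lambda>x. (x, 0))"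
    and \<pi>h: "snd \<circ> h = snd"
    using equiv by (auto simp: equivalent_ext_def)
  interpret h: module_hom "smul ?E" "smul ?E'" h
    using hom by (simp add: cmod_hom_def)
  define \<tau> where "\<tau> w = fst (h (0, w))" for w
  have h: "h (x, w) = (x + \<tau> w, w)" for x w
  proof -
    have "h (x, w) = h (x, 0) + h (0, w)"
      using h.add[of "(x, 0)" "(0, w)"] by simp
    moreover have "h (x, 0) = (x, 0)" "snd (h (0, w)) = w"
      using fun_cong[OF h\<iota>, of x] fun_cong[OF \<pi>h, of "(0, w)"] by simp_all
    ultimately show ?thesis by (simp add: prod_eq_iff \<tau>_def)
  qed
  have \<tau>_add: "\<tau> (w + w') = \<tau> w + \<tau> w'" for w w'
    using h.add[of "(0, w)" "(0, w')"] by (simp add: h)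
  interpret \<tau>: additive \<tau> by unfold_locales (rule \<tau>_add)
  have d: "fst z q w - fst z' q w = smul V q (\<tau> w) - \<tau> (smul W q w)" for q w
    using h.scale[of q "(0, w)"]
    by (simp add: h algebra_simps)
  have \<gamma>: "snd z a w - snd z' a w = act V a (\<tau> w) - map_poly \<tau> (act W a w)" for a w
  proof (rule poly_eqI)
    fix n
    have "coeff (act ?E' a (h (0, w))) n = h (coeff (act ?E a (0, w)) n)"
      using hom by (simp add: cmod_hom_def coeff_map_poly)
    then show "coeff (snd z a w - snd z' a w) n = coeff (act V a (\<tau> w) - map_poly \<tau> (act W a w)) n"
      by (simp add: h coeff_map_poly \<tau>.zero V.act_0_right algebra_simps)
  qed
  have "scalar_linear W V \<tau>"
    using d[of "[:_:]"] by (simp add: scalar_linear_def \<tau>_add const)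
  moreover have "z - z' = coboundary V W \<tau>"
    using d \<gamma> by (simp add: coboundary_def prod_eq_iff fun_eq_iff)
  ultimately show ?thesis by blast
qed

text \<open>
  Conversely, given \<open>\<tau>\<close>, the map \<open>(x, w) \<mapsto> (x + \<tau> w, w)\<close> is an embedding of the structure for
  \<open>z\<close> into the conformal module for \<open>z'\<close>, so the axioms are transported along it.
\<close>

lemma cocycle_of_coboundary:
  assumes V: "conformal_module R V" and W: "conformal_module R W"
    and z': "z' \<in> cocycles R W V"
    and \<tau>: "scalar_linear W V \<tau>" and diff: "z - z' = coboundary V W \<tau>"
  shows "z \<in> cocycles R W V"
    and "equivalent_ext (cochain_module V W z) (\<lambda>x. (x, 0)) snd
      (cochain_module V W z') (\<lambda>x. (x, 0)) snd"
proof -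
  let ?E = "cochain_module V W z" and ?E' = "cochain_module V W z'"
  interpret V: conformal_module R V by (rule V)
  interpret W: conformal_module R W by (rule W)
  have E': "conformal_module R ?E'" and const': "fst z' [:k:] w = 0" for k w
    using z' by (simp_all add: cocycles_def extension_def)
  interpret E': conformal_module R ?E' by (rule E')
  have \<tau>_add: "\<tau> (w + w') = \<tau> w + \<tau> w'"
    and \<tau>_scalar: "\<tau> (scalar W k w) = scalar V k (\<tau> w)" for w w' k
    using \<tau> by (simp_all add: scalar_linear_def)
  interpret \<tau>: additive \<tau> by unfold_locales (rule \<tau>_add)
  have d: "fst z q w = fst z' q w + smul V q (\<tau> w) - \<tau> (smul W q w)" for q w
    using arg_cong[OF diff, of "\<lambda>y. fst y q w"] by (simp add: coboundary_def algebra_simps)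
  have \<gamma>: "snd z a w = snd z' a w + act V a (\<tau> w) - map_poly \<tau> (act W a w)" for a w
    using arg_cong[OF diff, of "\<lambda>y. snd y a w"] by (simp add: coboundary_def algebra_simps)
  define h where "h = (\<lambda>(x, w). (x + \<tau> w, w))"
  have h_add: "h (x + y) = h x + h y" for x y
    by (cases x; cases y) (simp add: h_def \<tau>_add)
  have h_scale: "h (smul ?E q x) = smul ?E' q (h x)" for q x
    by (cases x) (simp add: h_def d V.mod_V.scale_right_distrib)
  have h0: "h 0 = 0"
    by (simp add: h_def zero_prod_def \<tau>.zero)
  have h_act: "map_poly h (act ?E a x) = act ?E' a (h x)" for a x
  proof (cases x)
    case (Pair y w)
    show ?thesis
      by (rule poly_eqI)
        (simp add: Pair coeff_map_poly h0, simp add: h_def \<gamma> V.act_add_right coeff_map_poly \<tau>.zero)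
  qed
  have "inj h" by (rule injI) (auto simp: h_def)
  then have E: "conformal_module R ?E"
    by (rule conformal_module_transport[OF E']) (rule h_add h_scale h_act)+
  have "fst z [:k:] w = 0" for k w
    by (simp add: d const' \<tau>_scalar)
  then show "z \<in> cocycles R W V"
    by (simp add: cocycles_def extension_cochain_module V W E)
  have "cmod_hom ?E ?E' h"
    using E E' by (simp add: cmod_hom_def module_hom_iff conformal_module.module_V h_add h_scale h_act)
  then show "equivalent_ext ?E (\<lambda>x. (x, 0)) snd ?E' (\<lambda>x. (x, 0)) snd"
    unfolding equivalent_ext_def
    by (intro exI[of _ h]) (auto simp: h_def \<tau>.zero)
qed

lemma trivial_cocycles_eq_coboundaries:
  assumes V: "conformal_module R V" and W: "conformal_module R W"
  shows "trivial_cocycles R W V = {coboundary V W \<tau> | \<tau>. scalar_linear W V \<tau>}"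
proof -
  have "conformal_module R (cochain_module V W 0)"
    using conformal_module_direct_sum[OF V W] by (simp add: direct_sum_eq_cochain_module)
  then have zero: "0 \<in> cocycles R W V"
    by (simp add: cocycles_def extension_cochain_module[OF V W])
  show ?thesis
  proof (intro set_eqI iffI)
    fix z assume "z \<in> trivial_cocycles R W V"
    then have "\<exists>\<tau>. scalar_linear W V \<tau> \<and> z - 0 = coboundary V W \<tau>"
      by (intro coboundary_of_equivalence[OF V])
        (simp_all add: trivial_cocycles_def trivial_ext_def direct_sum_eq_cochain_module cocycles_def)
    then show "z \<in> {coboundary V W \<tau> | \<tau>. scalar_linear W V \<tau>}" by auto
  next
    fix z assume "z \<in> {coboundary V W \<tau> | \<tau>. scalar_linear W V \<tau>}"
    then obtain \<tau> where "scalar_linear W V \<tau>" "z - 0 = coboundary V W \<tau>" by auto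
    from cocycle_of_coboundary[OF V W zero this] show "z \<in> trivial_cocycles R W V"
      by (simp add: trivial_cocycles_def trivial_ext_def direct_sum_eq_cochain_module)
  qed
qed

section \<open>Rank two algebras, free rank one modules and the module \<open>\<complex>c\<^bsub>\<eta>\<^esub>\<close>\<close>

context lie_conformal_algebra
begin

lemma ev_bracket_add_left:
    "ev R (bracket R (a + b) d) l = ev R (bracket R a d) l + ev R (bracket R b d) l"
  and ev_bracket_add_right:
    "ev R (bracket R d (a + b)) l = ev R (bracket R d a) l + ev R (bracket R d b) l"
  and ev_bracket_smul_left:
    "ev R (bracket R (smul R q a) b) l = scalar R (poly q (- l)) (ev R (bracket R a b) l)"
  and ev_bracket_smul_right:
    "ev R (bracket R a (smul R q b)) l = smul R (pcompose q [:l, 1:]) (ev R (bracket R a b) l)"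
proof -
  interpret adj: conformal_module R "\<lparr>smul = smul R, act = bracket R\<rparr>"
    by (rule conformal_module_adjoint)
  have ev: "subst_lam \<lparr>smul = smul R, act = bracket R\<rparr> = subst_lam R"
    by (simp add: subst_lam_def fun_eq_iff)
  show "ev R (bracket R (a + b) d) l = ev R (bracket R a d) l + ev R (bracket R b d) l"
    using adj.ev_act_add_left[of a b d l] by (simp add: ev)
  show "ev R (bracket R d (a + b)) l = ev R (bracket R d a) l + ev R (bracket R d b) l"
    using adj.ev_act_add_right[of d a b l] by (simp add: ev)
  show "ev R (bracket R (smul R q a) b) l = scalar R (poly q (- l)) (ev R (bracket R a b) l)"
    using adj.ev_act_smul_left[of q a b l] by (simp add: ev)
  show "ev R (bracket R a (smul R q b)) l = smul R (pcompose q [:l, 1:]) (ev R (bracket R a b) l)"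
    using adj.ev_act_smul_right[of a q b l] by (simp add: ev)
qed

end

context solvable_rank_two
begin

sublocale mod_R: module "smul R" by (rule module_R)

definition coord_A :: "'r \<Rightarrow> complex poly" where
  "coord_A a = mod_R.representation {A, B} a A"

definition coord_B :: "'r \<Rightarrow> complex poly" where
  "coord_B a = mod_R.representation {A, B} a B"

lemma basis_decomposition: "a = smul R (coord_A a) A + smul R (coord_B a) B"
  using mod_R.sum_representation_eq[of "{A, B}" a "{A, B}"] basis_independent basis_span basis_distinct
  by (simp add: coord_A_def coord_B_def)

lemma coord_B_add: "coord_B (a + b) = coord_B a + coord_B b"
  and coord_B_smul: "coord_B (smul R q a) = q * coord_B a"
  and coord_B_minus: "coord_B (- a) = - coord_B a"
  and coord_B_A: "coord_B A = 0"
  and coord_B_B: "coord_B B = 1"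
  using basis_independent basis_distinct
  by (auto simp: coord_B_def mod_R.representation_add mod_R.representation_scale
      mod_R.representation_neg mod_R.representation_basis basis_span)

lemma Q1_eq_0: "Q1 = 0" if "p \<noteq> 0"
proof -
  have "map_poly (\<lambda>k. [:k:]) p \<noteq> 0"
    using that by (simp add: map_poly_eq_0_iff)
  then show ?thesis using p_Q1 by simp
qed

lemma ev_bracket_A_B: "ev R (bracket R A B) l = scalar R (poly p l) B"
  by (simp add: bracket_A_B ev_poly_times module_R)

lemma ev_bracket_B_A: "ev R (bracket R B A) l = - smul R (pcompose p [:- l, - 1:]) B"
  by (subst skew) (simp add: bracket_A_B subst_lam_poly_times module_R)

text \<open>
  The bracket of two arbitrary elements when \<open>Q\<^sub>1 = 0\<close>. It lies in \<open>\<complex>[\<partial>] B\<close>, and the second term comes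
  from \<open>[B\<^bsub>\<lambda>\<^esub> A] = - p(- \<lambda> - \<partial>) B\<close>, given by skew-symmetry.
\<close>

lemma coord_B_bracket:
  assumes "Q1 = 0"
  shows "coord_B (ev R (bracket R a b) l) =
    [:poly (coord_A a) (- l) * poly p l:] * pcompose (coord_B b) [:l, 1:]
    - [:poly (coord_B a) (- l):] * pcompose (coord_A b) [:l, 1:] * pcompose p [:- l, - 1:]"
proof -
  have AA: "ev R (bracket R A A) l = 0" and BB: "ev R (bracket R B B) l = 0"
    by (simp_all add: bracket_A_A bracket_B_B assms subst_lam_0 module_R)
  have "ev R (bracket R a b) l =
      ev R (bracket R (smul R (coord_A a) A + smul R (coord_B a) B)
        (smul R (coord_A b) A + smul R (coord_B b) B)) l"
    by (simp only: basis_decomposition[symmetric])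
  also have "coord_B \<dots> =
    [:poly (coord_A a) (- l) * poly p l:] * pcompose (coord_B b) [:l, 1:]
    - [:poly (coord_B a) (- l):] * pcompose (coord_A b) [:l, 1:] * pcompose p [:- l, - 1:]"
    by (simp add: ev_bracket_add_left ev_bracket_add_right ev_bracket_smul_left
        ev_bracket_smul_right AA BB ev_bracket_A_B ev_bracket_B_A coord_B_add coord_B_smul
        coord_B_minus coord_B_B mult.commute del: mod_R.scale_minus_right)
  finally show ?thesis .
qed

lemma act_A_B:
  assumes "conformal_module R X"
  shows "ev X (act X A (ev X (act X B x) m)) l =
    scalar X (poly p l) (ev X (act X B x) (l + m)) + ev X (act X B (ev X (act X A x) l)) m"
proof -
  interpret X: conformal_module R X by (rule assms)
  show ?thesis
    using X.act_bracket[of A B x m l] by (simp add: ev_bracket_A_B X.ev_act_smul_left)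
qed

lemma act_A_A:
  assumes "conformal_module R X"
  shows "ev X (act X A (ev X (act X A x) m)) l =
    scalar X (poly (poly Q1 [:l:]) (- (l + m))) (ev X (act X B x) (l + m))
    + ev X (act X A (ev X (act X A x) l)) m"
proof -
  interpret X: conformal_module R X by (rule assms)
  have "ev R (bracket R A A) l = smul R (poly Q1 [:l:]) B"
    by (simp add: bracket_A_A subst_lam_map_smul module_R)
  then show ?thesis
    by (subst X.act_bracket) (simp add: X.ev_act_smul_left)
qed

lemma act_B_B:
  assumes "conformal_module R X"
  shows "ev X (act X B (ev X (act X B x) m)) l = ev X (act X B (ev X (act X B x) l)) m"
proof -
  interpret X: conformal_module R X by (rule assms)
  show ?thesis
    by (subst X.act_bracket)
      (simp add: bracket_B_B subst_lam_0 module_R X.module_V X.act_0_left)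
qed

end

locale rank_two_module_pair = solvable_rank_two R A B p Q1
  for R :: "('r::ab_group_add) lca" and A B :: 'r and p :: "complex poly"
    and Q1 :: "complex poly poly" +
  fixes V :: "('v::ab_group_add, 'r) cmod" and v :: 'v and \<phi>A \<phi>B :: "complex poly"
    and C :: "('c::ab_group_add, 'r) cmod" and c :: 'c and \<eta> :: complex
  assumes rank_one: "rank_one_module R A B V v \<phi>A \<phi>B"
    and nontrivial_V: "nontrivial_module V"
    and one_dim: "one_dim_module R C c \<eta>"
begin

sublocale V: conformal_module R V
  using rank_one by (simp add: rank_one_module_def)

sublocale C: conformal_module R C
  using one_dim by (simp add: one_dim_module_def)

lemma act_V_A: "act V A v = poly_times V \<phi>A v" and act_V_B: "act V B v = poly_times V \<phi>B v"
  using rank_one by (simp_all add: rank_one_module_def)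

definition coord_V :: "'v \<Rightarrow> complex poly" where
  "coord_V w = V.mod_V.representation {v} w v"

lemma span_v: "V.mod_V.span {v} = UNIV" and independent_v: "V.mod_V.independent {v}"
  using rank_one by (simp_all add: rank_one_module_def)

lemma smul_coord_V: "smul V (coord_V w) v = w"
  using V.mod_V.sum_representation_eq[of "{v}" w "{v}"] independent_v span_v
  by (simp add: coord_V_def)

lemma coord_V_add: "coord_V (w + w') = coord_V w + coord_V w'"
  and coord_V_smul: "coord_V (smul V q w) = q * coord_V w"
  and coord_V_v: "coord_V v = 1"
  unfolding coord_V_def
  by (simp_all only: V.mod_V.representation_add[OF independent_v]
      V.mod_V.representation_scale[OF independent_v] span_v UNIV_I
      V.mod_V.representation_basis[OF independent_v] insertI1 if_True simp_thms)

lemma smul_v_eq_iff: "smul V q v = smul V q' v \<longleftrightarrow> q = q'"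
proof
  assume "smul V q v = smul V q' v"
  then have "coord_V (smul V q v) = coord_V (smul V q' v)" by (rule arg_cong)
  then show "q = q'" by (simp only: coord_V_smul coord_V_v mult_1_right)
qed simp

lemma c_nonzero: "c \<noteq> 0" and ex_scalar_c: "\<exists>k. x = scalar C k c"
  using one_dim by (auto simp: one_dim_module_def)

lemma scalar_c_eq_0_iff: "scalar C k c = 0 \<longleftrightarrow> k = 0"
proof
  assume k: "scalar C k c = 0"
  show "k = 0"
  proof (rule ccontr)
    assume "k \<noteq> 0"
    then have "[:inverse k:] * [:k:] = 1" by (simp add: one_pCons)
    then have "c = scalar C (inverse k) (scalar C k c)"
      by (simp only: C.mod_V.scale_scale C.mod_V.scale_one)
    with k c_nonzero show False by simp
  qed
qed simp

lemma scalar_c_eq_iff: "scalar C k c = scalar C k' c \<longleftrightarrow> k = k'"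
  using scalar_c_eq_0_iff[of "k - k'"] C.mod_V.scale_left_diff_distrib[of "[:k:]" "[:k':]" c]
  by simp

lemma smul_c: "smul C q c = scalar C (poly q \<eta>) c"
proof (induction q)
  case 0
  then show ?case by simp
next
  case (pCons k q)
  have D: "D C c = scalar C \<eta> c"
    using one_dim by (simp add: one_dim_module_def)
  have "pCons k q = [:k:] + q * [:0, 1:]" by simp
  then have "smul C (pCons k q) c = scalar C k c + smul C q (D C c)"
    by (simp only: C.mod_V.scale_left_distrib C.mod_V.scale_scale)
  also have "smul C q (D C c) = scalar C \<eta> (smul C q c)"
    by (simp add: D mult.commute)
  also have "scalar C k c + \<dots> = smul C ([:k:] + [:\<eta>:] * [:poly q \<eta>:]) c"
    by (simp only: pCons.IH C.mod_V.scale_left_distrib C.mod_V.scale_scale)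
  finally show ?case by (simp add: mult.commute)
qed

lemma act_C: "act C a x = 0"
proof -
  obtain k where "x = scalar C k c" using ex_scalar_c by blast
  then show ?thesis
    using one_dim by (simp add: C.act_scalar_right one_dim_module_def)
qed

lemma phi_nonzero: "\<phi>A \<noteq> 0 \<or> \<phi>B \<noteq> 0"
proof (rule ccontr)
  assume "\<not> ?thesis"
  then have gen: "ev V (act V A v) l = 0" "ev V (act V B v) l = 0" for l
    by (simp_all add: act_V_A act_V_B ev_poly_times V.module_V)
  have "ev V (act V a x) l = ev V 0 l" for a x l
  proof -
    have "ev V (act V a x) l =
        ev V (act V (smul R (coord_A a) A + smul R (coord_B a) B) (smul V (coord_V x) v)) l"
      by (simp only: basis_decomposition[symmetric] smul_coord_V)
    also have "\<dots> = 0"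
      by (simp add: V.ev_act_add_left V.ev_act_smul_left V.ev_act_smul_right gen)
    finally show ?thesis by (simp add: subst_lam_0 V.module_V)
  qed
  then have "act V a x = 0" for a x
    by (rule ev_inject[OF V.module_V])
  with nontrivial_V show False by (simp add: nontrivial_module_def)
qed

text \<open>
  Since \<open>A\<close> and \<open>B\<close> act on \<open>v\<close> through commuting multiplications, \<open>[A\<^bsub>\<lambda>\<^esub> B] = p(\<lambda>) B\<close> forces
  \<open>p(\<lambda>) \<phi>B(\<lambda> + \<mu>) = 0\<close>.
\<close>

lemma phiB_eq_0: "\<phi>B = 0" if p: "p \<noteq> 0"
proof -
  obtain l where l: "poly p l \<noteq> 0"
    using p poly_all_0_iff_0[of p] by blast
  have "poly \<phi>B x = 0" for x
  proof -
    have "smul V [:poly \<phi>B (x - l) * poly \<phi>A l:] v =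
        smul V ([:poly p l * poly \<phi>B x:] + [:poly \<phi>B (x - l) * poly \<phi>A l:]) v"
      using act_A_B[OF V.conformal_module_axioms, of v "x - l" l]
      by (simp add: act_V_A act_V_B ev_poly_times V.module_V V.ev_act_smul_right
          V.mod_V.scale_left_distrib[symmetric] mult.commute)
    then have "[:poly p l * poly \<phi>B x:] = 0"
      by (simp only: smul_v_eq_iff add_cancel_right_left)
    with l show ?thesis by simp
  qed
  then show ?thesis using poly_all_0_iff_0[of \<phi>B] by blast
qed

end

section \<open>Lifts of the generator to an extension\<close>

locale rank_two_extension = rank_two_module_pair R A B p Q1 V v \<phi>A \<phi>B C c \<eta>
  for R :: "('r::ab_group_add) lca" and A B :: 'r and p :: "complex poly"
    and Q1 :: "complex poly poly"
    and V :: "('v::ab_group_add, 'r) cmod" and v :: 'v and \<phi>A \<phi>B :: "complex poly"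
    and C :: "('c::ab_group_add, 'r) cmod" and c :: 'c and \<eta> :: complex +
  fixes E :: "('e::ab_group_add, 'r) cmod" and \<iota> :: "'c \<Rightarrow> 'e" and \<pi> :: "'e \<Rightarrow> 'v"
  assumes ext: "extension R C E V \<iota> \<pi>"
begin

sublocale E: conformal_module R E
  using ext by (simp add: extension_def)

sublocale i: module_hom "smul C" "smul E" \<iota>
  using ext by (simp add: extension_def cmod_hom_def)

sublocale pi: module_hom "smul E" "smul V" \<pi>
  using ext by (simp add: extension_def cmod_hom_def)

lemma inj_i: "inj \<iota>" and exact: "\<pi> x = 0 \<longleftrightarrow> x \<in> range \<iota>" and surj_pi: "surj \<pi>"
  and act_pi: "act V a (\<pi> x) = map_poly \<pi> (act E a x)"
  using ext by (auto simp: extension_def cmod_hom_def)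

lemma pi_i: "\<pi> (\<iota> y) = 0"
  by (simp add: exact)

lemma act_i: "act E a (\<iota> y) = 0"
  using ext by (simp add: extension_def cmod_hom_def act_C)

lemma smul_i_c: "smul E q (\<iota> c) = scalar E (poly q \<eta>) (\<iota> c)"
  using arg_cong[OF smul_c[of q], of \<iota>] by (simp add: i.scale)

text \<open>
  Because \<open>V\<close> is free on \<open>v\<close>, a lift \<open>v'\<close> of \<open>v\<close> defines a \<open>\<complex>[\<partial>]\<close>-linear section of \<open>\<pi>\<close>; what remains
  of \<open>x\<close> after subtracting the section of \<open>\<pi> x\<close> lies in the image of \<open>C\<close>.
\<close>

definition retraction :: "'e \<Rightarrow> 'e \<Rightarrow> 'c" where
  "retraction v' x = inv \<iota> (x - smul E (coord_V (\<pi> x)) v')"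

context
  fixes v' :: 'e
  assumes lift: "\<pi> v' = v"
begin

lemma i_retraction: "\<iota> (retraction v' x) = x - smul E (coord_V (\<pi> x)) v'"
proof -
  have "\<pi> (x - smul E (coord_V (\<pi> x)) v') = 0"
    by (simp add: pi.diff pi.scale lift smul_coord_V)
  then show ?thesis
    by (simp add: retraction_def exact f_inv_into_f)
qed

lemma retraction_eqI: "x = \<iota> y + smul E q v' \<Longrightarrow> retraction v' x = y"
  by (simp add: retraction_def pi.add pi.scale pi_i lift coord_V_smul coord_V_v inj_i)

lemma retraction_i: "retraction v' (\<iota> y) = y"
  by (rule retraction_eqI[of _ _ 0]) simp

lemma retraction_lift: "retraction v' v' = 0"
  by (rule retraction_eqI[of _ _ 1]) simp

lemma decomposition: "x = \<iota> (retraction v' x) + smul E (coord_V (\<pi> x)) v'"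
  by (simp add: i_retraction)

lemma module_hom_retraction: "module_hom (smul E) (smul C) (retraction v')"
proof -
  have "retraction v' (x + y) = retraction v' x + retraction v' y" for x y
    by (rule retraction_eqI[of _ _ "coord_V (\<pi> (x + y))"])
      (simp add: i.add i_retraction pi.add coord_V_add E.mod_V.scale_left_distrib)
  moreover have "retraction v' (smul E q x) = smul C q (retraction v' x)" for q x
    by (rule retraction_eqI[of _ _ "coord_V (\<pi> (smul E q x))"])
      (simp add: i.scale i_retraction pi.scale coord_V_smul E.mod_V.scale_right_diff_distrib)
  ultimately show ?thesis
    by (simp add: module_hom_iff E.module_V C.module_V)
qed

lemma span_lift: "E.mod_V.span {\<iota> c, v'} = UNIV"
proof -
  have "x \<in> E.mod_V.span {\<iota> c, v'}" for x
  proof -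
    obtain k where "retraction v' x = scalar C k c" using ex_scalar_c by blast
    then have "x = scalar E k (\<iota> c) + smul E (coord_V (\<pi> x)) v'"
      using decomposition[of x] by (simp add: i.scale)
    moreover have "scalar E k (\<iota> c) + smul E (coord_V (\<pi> x)) v' \<in> E.mod_V.span {\<iota> c, v'}"
      by (intro E.mod_V.span_add E.mod_V.span_scale E.mod_V.span_base) simp_all
    ultimately show ?thesis by simp
  qed
  then show ?thesis by blast
qed

lemma unique_coordinates: "\<exists>!(k, q). x = scalar E k (\<iota> c) + smul E q v'"
proof -
  obtain k where k: "retraction v' x = scalar C k c" using ex_scalar_c by blast
  show ?thesis
  proof (rule ex1I[of _ "(k, coord_V (\<pi> x))"])
    show "case (k, coord_V (\<pi> x)) of (k, q) \<Rightarrow> x = scalar E k (\<iota> c) + smul E q v'"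
      using decomposition[of x] by (simp add: k i.scale)
  next
    fix kq assume "case kq of (k, q) \<Rightarrow> x = scalar E k (\<iota> c) + smul E q v'"
    then obtain k' q where kq: "kq = (k', q)" and x: "x = \<iota> (scalar C k' c) + smul E q v'"
      by (cases kq) (simp add: i.scale)
    have "scalar C k' c = scalar C k c"
      using retraction_eqI[OF x] k by simp
    moreover have "q = coord_V (\<pi> x)"
      by (simp add: x pi.add pi.scale pi_i lift coord_V_smul coord_V_v)
    ultimately show "kq = (k, coord_V (\<pi> x))"
      by (simp add: kq scalar_c_eq_iff)
  qed
qed

end

text \<open>The data \<open>(f, g)\<close> depends on the lift, and the arguments below change lifts, so \<open>v'\<close> is kept explicit.\<close>

definition lift_action :: "'e \<Rightarrow> complex poly \<Rightarrow> complex poly \<Rightarrow> bool" where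
  "lift_action v' f g \<longleftrightarrow> \<pi> v' = v \<and>
     act E A v' = poly_times E \<phi>A v' + poly_times E f (\<iota> c) \<and>
     act E B v' = poly_times E \<phi>B v' + poly_times E g (\<iota> c)"

lemma presented_by_iff_lift_action:
  "presented_by A B c \<eta> v \<phi>A \<phi>B E \<iota> \<pi> f g \<longleftrightarrow> (\<exists>v'. lift_action v' f g)"
proof
  assume "\<exists>v'. lift_action v' f g"
  then obtain v' where "lift_action v' f g" by blast
  then show "presented_by A B c \<eta> v \<phi>A \<phi>B E \<iota> \<pi> f g"
    unfolding presented_by_def lift_action_def
    using smul_i_c[of "[:0, 1:]"]
    by (intro exI[of _ "\<iota> c"] exI[of _ v'] conjI allI unique_coordinates) (simp_all add: act_i)
qed (auto simp: presented_by_def lift_action_def)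

lemma ex_poly_times_c:
  assumes "map_poly \<pi> u = 0"
  shows "\<exists>f. u = poly_times E f (\<iota> c)"
proof -
  \<comment> \<open>The coordinate on the line spanned by \<open>\<iota> c\<close>, in which all coefficients of \<open>u\<close> lie.\<close>
  define \<kappa> where "\<kappa> x = (SOME k. x = scalar E k (\<iota> c))" for x
  have \<kappa>: "\<kappa> (scalar E k (\<iota> c)) = k" for k
  proof -
    have "scalar E k (\<iota> c) = scalar E k' (\<iota> c) \<longleftrightarrow> k = k'" for k'
      using inj_eq[OF inj_i, of "scalar C k c" "scalar C k' c"]
      by (simp add: i.scale scalar_c_eq_iff)
    then show ?thesis by (simp add: \<kappa>_def)
  qed
  have "u = poly_times E (map_poly \<kappa> u) (\<iota> c)"
  proof (rule poly_eqI)
    fix n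
    have "\<pi> (coeff u n) = 0"
      using arg_cong[OF assms, of "\<lambda>w. coeff w n"] by (simp add: coeff_map_poly)
    then obtain y where "coeff u n = \<iota> y"
      by (auto simp: exact)
    moreover obtain k where "y = scalar C k c" using ex_scalar_c by blast
    ultimately have "coeff u n = scalar E k (\<iota> c)" by (simp add: i.scale)
    moreover have "\<kappa> 0 = 0" using \<kappa>[of 0] by simp
    ultimately show "coeff u n = coeff (poly_times E (map_poly \<kappa> u) (\<iota> c)) n"
      by (simp add: coeff_poly_times E.module_V coeff_map_poly \<kappa>)
  qed
  then show ?thesis by blast
qed

lemma ex_lift_action: "\<exists>v' f g. lift_action v' f g"
proof -
  obtain v' where v': "\<pi> v' = v"
    using surj_pi by (metis surjD)
  have ex: "\<exists>f. act E a v' = poly_times E \<phi> v' + poly_times E f (\<iota> c)"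
    if "act V a v = poly_times V \<phi> v" for a \<phi>
  proof -
    have "map_poly \<pi> (act E a v' + poly_times E (- \<phi>) v') = 0"
      using act_pi[of a v'] that
      by (simp add: map_poly_additive pi.add v' map_poly_poly_times[OF pi.module_hom_axioms]
          poly_times_minus V.module_V)
    then obtain f where "act E a v' + poly_times E (- \<phi>) v' = poly_times E f (\<iota> c)"
      using ex_poly_times_c by blast
    then have "act E a v' = poly_times E \<phi> v' + poly_times E f (\<iota> c)"
      by (simp add: poly_times_minus E.module_V algebra_simps)
    then show ?thesis by blast
  qed
  show ?thesis
    using ex[OF act_V_A] ex[OF act_V_B] v' by (auto simp: lift_action_def)
qed

text \<open>
  The module axiom for the pairs \<open>(A, A)\<close>, \<open>(A, B)\<close>, \<open>(B, B)\<close>, evaluated at \<open>v'\<close>, is an identity in \<open>E\<close>;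
  its component along \<open>c\<close> is a functional equation for \<open>f\<close> and \<open>g\<close>. That component is read off with
  the retraction of \<open>v'\<close>, which kills \<open>v'\<close> and is \<open>\<complex>[\<partial>]\<close>-linear.
\<close>

lemma lift_action_relations:
  assumes "lift_action v' f g"
  shows "poly \<phi>A m * poly f l =
      poly (poly Q1 [:l:]) (- (l + m)) * poly g (l + m) + poly \<phi>A l * poly f m"
    and "poly \<phi>B m * poly f l = poly p l * poly g (l + m) + poly \<phi>A l * poly g m"
    and "poly \<phi>B m * poly g l = poly \<phi>B l * poly g m"
proof -
  have lift: "\<pi> v' = v"
    and A: "act E A v' = poly_times E \<phi>A v' + poly_times E f (\<iota> c)"
    and B: "act E B v' = poly_times E \<phi>B v' + poly_times E g (\<iota> c)"
    using assms by (simp_all add: lift_action_def)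
  interpret \<rho>: module_hom "smul E" "smul C" "retraction v'"
    by (rule module_hom_retraction[OF lift])
  note \<rho>_simps = \<rho>.add \<rho>.scale retraction_i[OF lift] retraction_lift[OF lift]
  have ev: "ev E (poly_times E \<phi> v' + poly_times E h (\<iota> c)) l
      = scalar E (poly \<phi> l) v' + scalar E (poly h l) (\<iota> c)" for \<phi> h l
    by (simp add: subst_lam_add ev_poly_times E.module_V)
  have twice: "retraction v' (ev E (act E a (scalar E s v' + scalar E t (\<iota> c))) l)
      = scalar C (s * poly h l) c"
    if "act E a v' = poly_times E \<phi> v' + poly_times E h (\<iota> c)" for a \<phi> h s t l
    by (simp add: E.ev_act_add_right E.ev_act_smul_right that ev act_i subst_lam_0 E.module_V \<rho>_simps
        mult.commute)
  note comps = twice[OF A] twice[OF B]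
  show "poly \<phi>A m * poly f l =
      poly (poly Q1 [:l:]) (- (l + m)) * poly g (l + m) + poly \<phi>A l * poly f m"
    using arg_cong[OF act_A_A[OF E.conformal_module_axioms, of v' m l], of "retraction v'"]
    unfolding A B ev
    by (simp add: comps \<rho>_simps C.mod_V.scale_left_distrib[symmetric] scalar_c_eq_iff)
  show "poly \<phi>B m * poly f l = poly p l * poly g (l + m) + poly \<phi>A l * poly g m"
    using arg_cong[OF act_A_B[OF E.conformal_module_axioms, of v' m l], of "retraction v'"]
    unfolding A B ev
    by (simp add: comps \<rho>_simps C.mod_V.scale_left_distrib[symmetric] scalar_c_eq_iff)
  show "poly \<phi>B m * poly g l = poly \<phi>B l * poly g m"
    using arg_cong[OF act_B_B[OF E.conformal_module_axioms, of v' m l], of "retraction v'"]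
    unfolding A B ev
    by (simp add: comps scalar_c_eq_iff)
qed

text \<open>
  Another lift is \<open>v' + k c\<close>. The summand \<open>k c\<close> is annihilated by the action, but \<open>\<phi>A(\<lambda>) v'\<close>
  rewritten through the new lift contributes \<open>- k \<phi>A(\<lambda>) c\<close>.
\<close>

lemma lift_action_change:
  assumes "lift_action v' f g"
  shows "lift_action (v' + scalar E k (\<iota> c)) (f - smult k \<phi>A) (g - smult k \<phi>B)"
proof -
  have "act E a (scalar E k (\<iota> c)) = 0" for a
    by (simp add: i.scale[symmetric] act_i)
  moreover have "poly_times E (f - smult k \<phi>) (\<iota> c) = poly_times E f (\<iota> c) - poly_times E (smult k \<phi>) (\<iota> c)"
    for f \<phi>
    using poly_times_add[OF E.module_V, of f "- smult k \<phi>"] by (simp add: poly_times_minus E.module_V)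
  moreover have "\<pi> (v' + scalar E k (\<iota> c)) = v"
    using assms by (simp add: lift_action_def pi.add pi.scale pi_i)
  ultimately show ?thesis
    using assms
    by (simp add: lift_action_def E.act_add_right poly_times_vector_add E.module_V poly_times_scalar)
qed

text \<open>
  The retraction defined by a lift identifies \<open>E\<close>, over \<open>\<complex>[\<partial>]\<close>, with \<open>C \<oplus> V\<close>. So \<open>E\<close> is equivalent
  to any split cochain module in which \<open>A\<close> and \<open>B\<close> act on \<open>(0, v)\<close> as they do on \<open>v'\<close>.
\<close>

lemma equivalent_split_cochain:
  assumes lift: "lift_action v' f g"
    and E': "conformal_module R (cochain_module C V (\<lambda>q w. 0, \<gamma>))" (is "conformal_module R ?E'")
    and A: "\<gamma> A v = poly_times C f c" and B: "\<gamma> B v = poly_times C g c"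
  shows "equivalent_ext E \<iota> \<pi> (cochain_module C V (\<lambda>q w. 0, \<gamma>)) (\<lambda>x. (x, 0)) snd"
proof -
  interpret E': conformal_module R ?E' by (rule E')
  have v': "\<pi> v' = v"
    and actA: "act E A v' = poly_times E \<phi>A v' + poly_times E f (\<iota> c)"
    and actB: "act E B v' = poly_times E \<phi>B v' + poly_times E g (\<iota> c)"
    using lift by (simp_all add: lift_action_def)
  interpret \<rho>: module_hom "smul E" "smul C" "retraction v'"
    by (rule module_hom_retraction[OF v'])
  define h where "h x = (retraction v' x, \<pi> x)" for x
  have h: "module_hom (smul E) (smul ?E') h"
    by (simp add: module_hom_iff E.module_V E'.module_V h_def \<rho>.add \<rho>.scale pi.add pi.scale)
  interpret h: module_hom "smul E" "smul ?E'" h by (rule h)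
  have \<gamma>0: "\<gamma> a 0 = 0" for a
    using E'.act_0_right[of a] coeff_act_cochain_module[of C V "(\<lambda>q w. 0, \<gamma>)" a 0 0]
    by (simp add: zero_prod_def poly_eq_iff C.act_0_right)
  have act_h: "act ?E' a (h v') = map_poly h (act E a v')"
    if "act E a v' = poly_times E \<phi> v' + poly_times E r (\<iota> c)" and "act V a v = poly_times V \<phi> v"
      and "\<gamma> a v = poly_times C r c" for a \<phi> r
  proof -
    have "map_poly h (act E a v') = poly_times ?E' \<phi> (h v') + poly_times ?E' r (h (\<iota> c))"
      by (simp only: that map_poly_additive[OF h.add] map_poly_poly_times[OF h])
    moreover have "h v' = (0, v)" "h (\<iota> c) = (c, 0)"
      by (simp_all add: h_def retraction_lift[OF v'] retraction_i[OF v'] v' pi_i)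
    ultimately show ?thesis
      by (simp add: poly_eq_iff coeff_poly_times E'.module_V C.module_V V.module_V act_C that(2,3))
  qed
  have "cmod_hom E ?E' h"
  proof (rule cmod_hom_of_generators[OF E.conformal_module_axioms E' h basis_span span_lift[OF v']])
    fix a x assume "a \<in> {A, B}" and "x \<in> {\<iota> c, v'}"
    moreover have "act ?E' a (h (\<iota> c)) = map_poly h (act E a (\<iota> c))"
      by (simp add: h_def retraction_i[OF v'] pi_i act_i poly_eq_iff act_C \<gamma>0 V.act_0_right
          zero_prod_def)
    ultimately show "act ?E' a (h x) = map_poly h (act E a x)"
      using act_h[OF actA act_V_A A] act_h[OF actB act_V_B B] by auto
  qed
  then show ?thesis
    unfolding equivalent_ext_def
    by (intro exI[of _ h]) (auto simp: h_def retraction_i[OF v'] pi_i)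
qed

lemma trivial_if_lift_action_0:
  assumes "lift_action v' 0 0"
  shows "trivial_ext C E V \<iota> \<pi>"
proof -
  have "direct_sum C V = cochain_module C V (\<lambda>q w. 0, \<lambda>a w. 0)"
    by (simp add: direct_sum_eq_cochain_module zero_prod_def zero_fun_def)
  then show ?thesis
    using equivalent_split_cochain[OF assms, of "\<lambda>a w. 0"]
      conformal_module_direct_sum[OF C.conformal_module_axioms V.conformal_module_axioms]
    by (simp add: trivial_ext_def poly_times_0 C.module_V)
qed

text \<open>
  Where \<open>B\<close> acts by zero on \<open>C\<close> and on \<open>V\<close> it acts by zero on \<open>C \<oplus> V\<close>, so in a trivial extension the
  polynomial \<open>g\<close> of every lift vanishes.
\<close>

lemma not_trivial:
  assumes "lift_action v' f g" and "\<phi>B = 0" and "g \<noteq> 0"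
  shows "\<not> trivial_ext C E V \<iota> \<pi>"
proof
  assume "trivial_ext C E V \<iota> \<pi>"
  then obtain h where hom: "cmod_hom E (direct_sum C V) h" and h\<iota>: "h \<circ> \<iota> = (\<lambda>x. (x, 0))"
    and \<pi>h: "snd \<circ> h = \<pi>"
    by (auto simp: trivial_ext_def equivalent_ext_def)
  interpret h: module_hom "smul E" "smul (direct_sum C V)" h
    using hom by (simp add: cmod_hom_def)
  have actB: "act E B v' = poly_times E \<phi>B v' + poly_times E g (\<iota> c)"
    using assms(1) by (simp add: lift_action_def)
  obtain n where n: "coeff g n \<noteq> 0"
    using \<open>g \<noteq> 0\<close> by (auto simp: poly_eq_iff)
  have "coeff (act E B v') n = \<iota> (scalar C (coeff g n) c)"
    using actB by (simp add: \<open>\<phi>B = 0\<close> poly_times_0 coeff_poly_times E.module_V i.scale)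
  then have "fst (h (coeff (act E B v') n)) = scalar C (coeff g n) c"
    using fun_cong[OF h\<iota>, of "scalar C (coeff g n) c"] by simp
  moreover have "h (coeff (act E B v') n) = coeff (act (direct_sum C V) B (h v')) n"
    using hom by (simp add: cmod_hom_def coeff_map_poly)
  moreover have "fst (coeff (act (direct_sum C V) B (h v')) n) = 0"
    by (cases "h v'") (simp add: direct_sum_eq_cochain_module act_C)
  ultimately show False
    using n by (simp add: scalar_c_eq_0_iff)
qed

end

section \<open>Solving the functional equations\<close>

lemma poly_eqI_eval:
  fixes q r :: "complex poly"
  assumes "\<And>x. poly q x = poly r x"
  shows "q = r"
proof -
  have "poly q = poly r" by (rule ext) (rule assms)
  then show ?thesis by (simp only: poly_eq_poly_eq_iff)
qed

lemma proportional_if_cross_products_agree: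
  fixes \<phi> f :: "complex poly"
  assumes "\<phi> \<noteq> 0" and "\<And>l m. poly \<phi> m * poly f l = poly \<phi> l * poly f m"
  shows "\<exists>k. f = smult k \<phi>"
proof -
  obtain m where m: "poly \<phi> m \<noteq> 0"
    using assms(1) poly_all_0_iff_0[of \<phi>] by blast
  have "poly f l = poly (smult (poly f m / poly \<phi> m) \<phi>) l" for l
    using assms(2)[of m l] m by (simp add: field_simps)
  then have "f = smult (poly f m / poly \<phi> m) \<phi>" by (rule poly_eqI_eval)
  then show ?thesis ..
qed

text \<open>
  For fixed \<open>\<lambda>\<close>, the polynomials \<open>g(\<lambda> + \<mu>)\<close> and \<open>g(\<mu>)\<close> in \<open>\<mu>\<close> have the same leading coefficient;
  comparing those gives \<open>q = - p\<close>. Then \<open>g(\<lambda>) = g(0)\<close> at all \<open>\<lambda>\<close> outside the zeros of \<open>p\<close>.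
\<close>

lemma constant_if_translation_proportional:
  fixes p q g :: "complex poly"
  assumes "p \<noteq> 0" and "g \<noteq> 0"
    and eq: "\<And>l m. poly p l * poly g (l + m) + poly q l * poly g m = 0"
  shows "q = - p" and "\<exists>k. k \<noteq> 0 \<and> g = [:k:]"
proof -
  have "poly q l = poly (- p) l" for l
  proof -
    have "poly (smult (poly p l) (pcompose g [:l, 1:]) + smult (poly q l) g) m = 0" for m
      using eq[of l m] by (simp add: poly_pcompose add.commute)
    then have "smult (poly p l) (pcompose g [:l, 1:]) + smult (poly q l) g = 0"
      by (intro poly_eqI_eval) simp
    from arg_cong[OF this, of "\<lambda>u. coeff u (degree g)"]
    have "poly p l * coeff (pcompose g [:l, 1:]) (degree g) + poly q l * lead_coeff g = 0"
      by simp
    moreover have "coeff (pcompose g [:l, 1:]) (degree g) = lead_coeff g"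
      using lead_coeff_comp[of "[:l, 1:]" g] by (simp add: degree_pcompose)
    ultimately have "(poly p l + poly q l) * lead_coeff g = 0"
      by (simp add: distrib_right)
    with \<open>g \<noteq> 0\<close> show ?thesis by (simp add: eq_neg_iff_add_eq_0 add.commute)
  qed
  then show q: "q = - p" by (rule poly_eqI_eval)
  have "poly ((g - [:poly g 0:]) * p) l = 0" for l
    using eq[of l 0] by (simp add: q algebra_simps)
  then have "(g - [:poly g 0:]) * p = 0"
    by (intro poly_eqI_eval) simp
  with \<open>p \<noteq> 0\<close> have "g = [:poly g 0:]" by simp
  with \<open>g \<noteq> 0\<close> show "\<exists>k. k \<noteq> 0 \<and> g = [:k:]"
    by (intro exI[of _ "poly g 0"]) auto
qed

text \<open>
  If \<open>p = 0\<close>, the second and third relations make \<open>(f, g)\<close> a multiple of \<open>(\<phi>A, \<phi>B)\<close> as soon as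
  \<open>\<phi>B \<noteq> 0\<close>; if \<open>\<phi>B = 0\<close>, the second kills \<open>g\<close>, and the first loses its \<open>Q\<^sub>1\<close>-term. Either way a change of
  the lift makes \<open>f\<close> and \<open>g\<close> vanish. If \<open>p \<noteq> 0\<close>, only \<open>f\<close> can be removed this way.
\<close>

lemma (in rank_two_extension) lift_normal_form:
  "(\<exists>v'. lift_action v' 0 0) \<or>
   p \<noteq> 0 \<and> \<phi>A = - p \<and> (\<exists>v' k. k \<noteq> 0 \<and> lift_action v' 0 [:k:])"
proof -
  obtain v' f g where vfg: "lift_action v' f g"
    using ex_lift_action by blast
  note rel = lift_action_relations[OF vfg]
  consider "p = 0" "\<phi>B \<noteq> 0" | "p = 0" "\<phi>B = 0" | "p \<noteq> 0" by blast
  then show ?thesis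
  proof cases
    case 1
    from proportional_if_cross_products_agree[OF \<open>\<phi>B \<noteq> 0\<close> rel(3)]
    obtain k where g: "g = smult k \<phi>B" by blast
    obtain m where m: "poly \<phi>B m \<noteq> 0"
      using \<open>\<phi>B \<noteq> 0\<close> poly_all_0_iff_0[of \<phi>B] by blast
    have "poly f l = poly (smult k \<phi>A) l" for l
      using rel(2)[of m l] m \<open>p = 0\<close> by (simp add: g)
    then have "f = smult k \<phi>A" by (rule poly_eqI_eval)
    with lift_action_change[OF vfg, of k] g show ?thesis by auto
  next
    case 2
    then have "\<phi>A \<noteq> 0" using phi_nonzero by blast
    then obtain l where l: "poly \<phi>A l \<noteq> 0"
      using poly_all_0_iff_0[of \<phi>A] by blast
    have "poly g m = 0" for m
      using rel(2)[of m l] l 2 by simp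
    then have g: "g = 0" by (intro poly_eqI_eval) simp
    have "poly \<phi>A m * poly f l = poly \<phi>A l * poly f m" for l m
      using rel(1)[of m l] by (simp add: g)
    from proportional_if_cross_products_agree[OF \<open>\<phi>A \<noteq> 0\<close> this]
    obtain k where "f = smult k \<phi>A" by blast
    then show ?thesis
      using lift_action_change[OF vfg, of k] g \<open>\<phi>B = 0\<close> by auto
  next
    case 3
    note \<phi>B = phiB_eq_0[OF 3]
    then have "\<phi>A \<noteq> 0" using phi_nonzero by blast
    \<comment> \<open>After removing \<open>f\<close> by a change of the lift, \<open>g\<close> is the same polynomial, because \<open>\<phi>B = 0\<close>.\<close>
    have "poly \<phi>A m * poly f l = poly \<phi>A l * poly f m" for l m
      using rel(1)[of m l] by (simp add: Q1_eq_0[OF 3])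
    from proportional_if_cross_products_agree[OF \<open>\<phi>A \<noteq> 0\<close> this]
    obtain k where f: "f = smult k \<phi>A" by blast
    have vg: "lift_action (v' + scalar E k (\<iota> c)) 0 g"
      using lift_action_change[OF vfg, of k] by (simp add: f) (simp add: \<phi>B)
    have eq: "poly p l * poly g (l + m) + poly \<phi>A l * poly g m = 0" for l m
      using rel(2)[of m l] by (simp add: \<phi>B)
    show ?thesis
    proof (cases "g = 0")
      case True
      then show ?thesis using vg by blast
    next
      case False
      from constant_if_translation_proportional[OF 3 False eq] vg 3
      show ?thesis by blast
    qed
  qed
qed

section \<open>The extensions of \<open>V\<^bsub>- p, 0\<^esub>\<close>\<close>

context rank_two_module_pair
begin

text \<open>
  The map \<open>\<gamma>\<close> of the extension with \<open>f = 0\<close> and \<open>g = k\<close>: for \<open>a = a\<^sub>1(\<partial>) A + a\<^sub>2(\<partial>) B\<close> and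
  \<open>w = r(\<partial>) v\<close>, sesquilinearity gives \<open>a\<^sub>2(- \<lambda>) r(\<eta> + \<lambda>) k c\<close>.
\<close>

definition std_action :: "complex \<Rightarrow> 'r \<Rightarrow> 'v \<Rightarrow> 'c poly" where
  "std_action k a w =
     poly_times C (smult k (pcompose (coord_B a) [:0, - 1:] * pcompose (coord_V w) [:\<eta>, 1:])) c"

definition std_cochain :: "complex \<Rightarrow> ('c, 'v, 'r) cochain" where
  "std_cochain k = (\<lambda>q w. 0, std_action k)"

lemma std_action_A: "std_action k A v = poly_times C 0 c"
  and std_action_B: "std_action k B v = poly_times C [:k:] c"
  by (simp_all add: std_action_def coord_B_A coord_B_B coord_V_v pcompose_1)

lemma ev_std_action:
  "ev C (std_action k a w) l = scalar C (k * (poly (coord_B a) (- l) * poly (coord_V w) (\<eta> + l))) c"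
  by (simp add: std_action_def ev_poly_times C.module_V poly_pcompose)

text \<open>
  The cocycle condition is where \<open>\<phi>A = - p\<close> enters: applied to \<open>a = A\<close>, \<open>b = B\<close>, \<open>w = v\<close>, it reads
  \<open>p(\<lambda>) k + \<phi>A(\<lambda>) k = 0\<close>.
\<close>

lemma conformal_module_std_cochain:
  assumes "p \<noteq> 0" and "\<phi>A = - p"
  shows "conformal_module R (cochain_module C V (std_cochain k))"
  unfolding std_cochain_def
proof (rule conformal_module_split_cochain[OF C.conformal_module_axioms V.conformal_module_axioms])
  have \<phi>B: "\<phi>B = 0" and Q1: "Q1 = 0"
    using phiB_eq_0 Q1_eq_0 assms(1) by blast+
  have coord_act: "coord_V (ev V (act V a w) l) =
      [:poly (coord_A a) (- l) * poly \<phi>A l:] * pcompose (coord_V w) [:l, 1:]" for a w l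
  proof -
    have "ev V (act V a w) l =
        ev V (act V (smul R (coord_A a) A + smul R (coord_B a) B) (smul V (coord_V w) v)) l"
      by (simp only: basis_decomposition[symmetric] smul_coord_V)
    also have "coord_V \<dots> = [:poly (coord_A a) (- l) * poly \<phi>A l:] * pcompose (coord_V w) [:l, 1:]"
      by (simp add: V.ev_act_add_left V.ev_act_smul_left V.ev_act_smul_right act_V_A act_V_B \<phi>B
          poly_times_0 ev_poly_times V.module_V subst_lam_0 coord_V_smul coord_V_v mult.commute)
    finally show ?thesis .
  qed
  show "std_action k (a + b) w = std_action k a w + std_action k b w" for a b w
    by (simp add: std_action_def coord_B_add pcompose_add distrib_right smult_add_right
        poly_times_add C.module_V)
  show "std_action k a (w + w') = std_action k a w + std_action k a w'" for a w w'
    by (simp add: std_action_def coord_V_add pcompose_add distrib_left smult_add_right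
        poly_times_add C.module_V)
  show "std_action k (scalar R s a) w = map_poly (scalar C s) (std_action k a w)" for s a w
    by (simp add: std_action_def coord_B_smul pcompose_smult poly_times_scalar C.module_V
        mult.commute)
  show "std_action k a (scalar V s w) = map_poly (scalar C s) (std_action k a w)" for s a w
    by (simp add: std_action_def coord_V_smul pcompose_smult poly_times_scalar C.module_V
        mult.commute)
  show "ev C (std_action k (D R a) w) l = smul C [:- l:] (ev C (std_action k a w) l)" for a w l
    by (simp add: ev_std_action coord_B_smul algebra_simps)
  show "ev C (std_action k a (D V w)) l = smul C [:l, 1:] (ev C (std_action k a w) l)" for a w l
  proof -
    have "smul C [:l, 1:] (scalar C s c) = scalar C ((\<eta> + l) * s) c" for s
      using smul_c[of "[:l, 1:] * [:s:]"] by (simp add: algebra_simps)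
    then show ?thesis
      unfolding ev_std_action by (simp only: coord_V_smul) (simp add: algebra_simps)
  qed
  show "ev C (act C a (ev C (std_action k b w) m)) l
      + ev C (std_action k a (ev V (act V b w) m)) l =
      ev C (std_action k (ev R (bracket R a b) l) w) (l + m) +
      (ev C (act C b (ev C (std_action k a w) l)) m
        + ev C (std_action k b (ev V (act V a w) l)) m)" for a b w l m
    by (simp add: act_C subst_lam_0 C.module_V ev_std_action coord_B_bracket[OF Q1] coord_act
        poly_pcompose assms(2) C.mod_V.scale_left_distrib[symmetric] scalar_c_eq_iff algebra_simps)
qed

lemma extension_std_cochain:
  assumes "p \<noteq> 0" and "\<phi>A = - p"
  shows "extension R C (cochain_module C V (std_cochain k)) V (\<lambda>x. (x, 0)) snd"
  by (rule extension_cochain_module[OF C.conformal_module_axioms V.conformal_module_axioms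
        conformal_module_std_cochain[OF assms]])

lemma std_cochain_in_cocycles:
  assumes "p \<noteq> 0" and "\<phi>A = - p"
  shows "std_cochain k \<in> cocycles R V C"
  using extension_std_cochain[OF assms, of k] by (simp add: cocycles_def) (simp add: std_cochain_def)

lemma presented_by_std_cochain:
  assumes "p \<noteq> 0" and "\<phi>A = - p"
  shows "presented_by A B c \<eta> v \<phi>A \<phi>B (cochain_module C V (std_cochain k)) (\<lambda>x. (x, 0)) snd 0 [:k:]"
proof -
  let ?E = "cochain_module C V (std_cochain k)"
  interpret S: rank_two_extension R A B p Q1 V v \<phi>A \<phi>B C c \<eta> ?E "\<lambda>x. (x, 0)" snd
    by unfold_locales (rule extension_std_cochain[OF assms])
  have "S.lift_action (0, v) 0 [:k:]"
    unfolding S.lift_action_def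
    by (simp add: poly_eq_iff coeff_poly_times S.E.module_V C.act_0_right)
      (simp add: coeff_poly_times C.module_V V.module_V std_cochain_def std_action_A std_action_B
        act_V_A act_V_B)
  then show ?thesis
    using S.presented_by_iff_lift_action by blast
qed

lemma cochain_scale_std: "cochain_scale C s (std_cochain k) = std_cochain (s * k)"
  by (simp add: cochain_scale_def std_cochain_def std_action_def poly_times_scalar C.module_V
      fun_eq_iff)

end

context rank_two_extension
begin

lemma equivalent_std_cochain:
  assumes "p \<noteq> 0" and "\<phi>A = - p" and "lift_action v' 0 [:k:]"
  shows "equivalent_ext E \<iota> \<pi> (cochain_module C V (std_cochain k)) (\<lambda>x. (x, 0)) snd"
  using equivalent_split_cochain[OF assms(3), of "std_action k"]
    conformal_module_std_cochain[OF assms(1,2), of k]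
  by (simp add: std_cochain_def std_action_A std_action_B)

lemma nontrivial_extension:
  assumes "\<not> trivial_ext C E V \<iota> \<pi>"
  shows "p \<noteq> 0" and "Q1 = 0" and "\<phi>A = - p" and "\<phi>B = 0"
    and "\<exists>v' k. k \<noteq> 0 \<and> lift_action v' 0 [:k:]"
proof -
  have nf: "p \<noteq> 0 \<and> \<phi>A = - p \<and> (\<exists>v' k. k \<noteq> 0 \<and> lift_action v' 0 [:k:])"
    using lift_normal_form trivial_if_lift_action_0 assms by blast
  then show "p \<noteq> 0" "\<phi>A = - p" "\<exists>v' k. k \<noteq> 0 \<and> lift_action v' 0 [:k:]" by blast+
  then show "Q1 = 0" "\<phi>B = 0" using Q1_eq_0 phiB_eq_0 by blast+
qed

end

section \<open>The dimension of \<open>Ext\<close>\<close>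

context rank_two_module_pair
begin

lemma rank_two_extensionI:
  "extension R C E V \<iota> \<pi> \<Longrightarrow> rank_two_extension R A B p Q1 V v \<phi>A \<phi>B C c \<eta> E \<iota> \<pi>"
  by unfold_locales

lemma not_trivial_if_presented_by:
  assumes E: "extension R C E V \<iota> \<pi>" and fg: "presented_by A B c \<eta> v \<phi>A \<phi>B E \<iota> \<pi> f g"
    and "\<phi>B = 0" and "g \<noteq> 0"
  shows "\<not> trivial_ext C E V \<iota> \<pi>"
proof -
  interpret E: rank_two_extension R A B p Q1 V v \<phi>A \<phi>B C c \<eta> E \<iota> \<pi>
    by (rule rank_two_extensionI[OF E])
  obtain v' where "E.lift_action v' f g"
    using fg by (auto simp: E.presented_by_iff_lift_action)
  then show ?thesis
    using assms(3,4) by (rule E.not_trivial)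
qed

lemma Ext_dim_0:
  assumes "\<phi>A \<noteq> - p"
  shows "Ext_has_dim R V C 0"
proof -
  have "z \<in> trivial_cocycles R V C" if z: "z \<in> cocycles R V C" for z
  proof -
    interpret Z: rank_two_extension R A B p Q1 V v \<phi>A \<phi>B C c \<eta> "cochain_module C V z"
      "\<lambda>x. (x, 0)" snd
      using z by (intro rank_two_extensionI) (simp add: cocycles_def)
    show ?thesis
      using Z.nontrivial_extension(3) assms z by (auto simp: trivial_cocycles_def)
  qed
  then show ?thesis
    by (auto simp: Ext_has_dim_def quotient_has_dim_def intro!: exI[of _ "\<lambda>_. 0"])
qed

text \<open>
  The class of \<open>std_cochain 1\<close> is a basis. It spans because every cocycle gives an extension equivalent
  to that of some \<open>std_cochain k\<close>. The number \<open>k\<close> is unique because coboundaries vanish at \<open>(B, v)\<close>,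
  where \<open>std_cochain k\<close> takes the value \<open>k c\<close>.
\<close>

lemma Ext_dim_1:
  assumes p: "p \<noteq> 0" and \<phi>A: "\<phi>A = - p"
  shows "Ext_has_dim R V C 1"
proof -
  note trivial = trivial_cocycles_eq_coboundaries[OF C.conformal_module_axioms V.conformal_module_axioms]
  have exists: "\<exists>k. z - std_cochain k \<in> trivial_cocycles R V C" if z: "z \<in> cocycles R V C" for z
  proof -
    interpret Z: rank_two_extension R A B p Q1 V v \<phi>A \<phi>B C c \<eta> "cochain_module C V z"
      "\<lambda>x. (x, 0)" snd
      using z by (intro rank_two_extensionI) (simp add: cocycles_def)
    obtain v' k where "Z.lift_action v' 0 [:k:]"
      using Z.lift_normal_form pCons_0_0 by metis
    from Z.equivalent_std_cochain[OF p \<phi>A this]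
    have "\<exists>\<tau>. scalar_linear V C \<tau> \<and> z - std_cochain k = coboundary C V \<tau>"
      by (rule coboundary_of_equivalence[OF C.conformal_module_axioms])
        (use z std_cochain_in_cocycles[OF p \<phi>A] in \<open>simp_all add: cocycles_def\<close>)
    then show ?thesis by (auto simp: trivial)
  qed
  have unique: "k = k'"
    if "z - std_cochain k \<in> trivial_cocycles R V C" "z - std_cochain k' \<in> trivial_cocycles R V C"
    for z k k'
  proof -
    have "snd z B v = poly_times C [:k:] c" if diff: "z - std_cochain k \<in> trivial_cocycles R V C" for k
    proof -
      obtain \<tau> where \<tau>: "z - std_cochain k = coboundary C V \<tau>"
        using diff by (auto simp: trivial)
      have "snd z B v - std_action k B v = act C B (\<tau> v) - map_poly \<tau> (act V B v)"
        using arg_cong[OF \<tau>, of "\<lambda>y. snd y B v"] by (simp add: coboundary_def std_cochain_def)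
      also have "act V B v = 0"
        by (simp add: act_V_B phiB_eq_0[OF p] poly_times_0 V.module_V)
      finally show ?thesis by (simp add: act_C std_action_B)
    qed
    from this[OF that(1)] this[OF that(2)]
    have "coeff (poly_times C [:k:] c) 0 = coeff (poly_times C [:k':] c) 0" by simp
    then show ?thesis by (simp add: coeff_poly_times C.module_V scalar_c_eq_iff)
  qed
  \<comment> \<open>Coefficient families are required to vanish from index \<open>1\<close> on, so they amount to one number \<open>s 0\<close>.\<close>
  have "\<exists>!s. (\<forall>i\<ge>1::nat. s i = 0) \<and>
      z - (\<Sum>i<1::nat. cochain_scale C (s i) (std_cochain 1)) \<in> trivial_cocycles R V C"
    if z: "z \<in> cocycles R V C" for z
  proof -
    obtain k where k: "z - std_cochain k \<in> trivial_cocycles R V C"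
      using exists[OF z] by blast
    show ?thesis
    proof (rule ex1I[of _ "\<lambda>i. if i = 0 then k else 0"])
      show "(\<forall>i\<ge>1::nat. (if i = 0 then k else 0) = 0) \<and>
          z - (\<Sum>i<1::nat. cochain_scale C (if i = 0 then k else 0) (std_cochain 1))
            \<in> trivial_cocycles R V C"
        using k by (simp add: cochain_scale_std)
    next
      fix s :: "nat \<Rightarrow> complex"
      assume s: "(\<forall>i\<ge>1. s i = 0) \<and>
        z - (\<Sum>i<1. cochain_scale C (s i) (std_cochain 1)) \<in> trivial_cocycles R V C"
      then have "s 0 = k"
        using unique[OF _ k] by (simp add: cochain_scale_std)
      then show "s = (\<lambda>i. if i = 0 then k else 0)"
        using s by (auto simp: fun_eq_iff)
    qed
  qed
  then show ?thesis
    unfolding Ext_has_dim_def quotient_has_dim_def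
    by (intro exI[of _ "\<lambda>_. std_cochain 1"]) (simp add: std_cochain_in_cocycles[OF p \<phi>A])
qed

end

section \<open>The classification of extensions of \<open>V\<^bsub>\<phi>A,\<phi>B\<^esub>\<close> by \<open>\<complex>c\<^bsub>\<eta>\<^esub>\<close>\<close>

theorem theorem4p3:
  fixes R :: "('r::ab_group_add) lca"
    and A B :: 'r
    and p :: "complex poly"
    and Q1 :: "complex poly poly"
    and V :: "('v::ab_group_add, 'r) cmod"
    and v :: 'v
    and \<phi>A \<phi>B :: "complex poly"
    and C :: "('c::ab_group_add, 'r) cmod"
    and c :: 'c
    and \<eta> :: complex
  assumes "solvable_rank_two R A B p Q1"
    and "rank_one_module R A B V v \<phi>A \<phi>B"
    and "irreducible_module R V" and "finite_module V" and "nontrivial_module V"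
    and "one_dim_module R C c \<eta>"
  shows
    "(\<forall>(E :: ('e::ab_group_add, 'r) cmod) \<iota> \<pi>. extension R C E V \<iota> \<pi> \<longrightarrow>
        (\<exists>f g. presented_by A B c \<eta> v \<phi>A \<phi>B E \<iota> \<pi> f g)) \<and>
     (\<forall>(E :: ('e, 'r) cmod) \<iota> \<pi>. extension R C E V \<iota> \<pi> \<and> \<not> trivial_ext C E V \<iota> \<pi> \<longrightarrow>
        p \<noteq> 0 \<and> Q1 = 0) \<and>
     (\<forall>(E :: ('e, 'r) cmod) \<iota> \<pi>. extension R C E V \<iota> \<pi> \<and> \<not> trivial_ext C E V \<iota> \<pi> \<longrightarrow>
        \<phi>A = - p \<and> \<phi>B = 0 \<and>
        (\<exists>k. k \<noteq> 0 \<and>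
          (\<exists>(E' :: ('c \<times> 'v, 'r) cmod) \<iota>' \<pi>'.
             extension R C E' V \<iota>' \<pi>' \<and> equivalent_ext E \<iota> \<pi> E' \<iota>' \<pi>' \<and>
             presented_by A B c \<eta> v \<phi>A \<phi>B E' \<iota>' \<pi>' 0 [:k:]))) \<and>
     (p \<noteq> 0 \<and> Q1 = 0 \<and> \<phi>A = - p \<and> \<phi>B = 0 \<longrightarrow>
        (\<forall>k. k \<noteq> 0 \<longrightarrow>
          (\<exists>(E :: ('c \<times> 'v, 'r) cmod) \<iota> \<pi>.
             extension R C E V \<iota> \<pi> \<and> \<not> trivial_ext C E V \<iota> \<pi> \<and>
             presented_by A B c \<eta> v \<phi>A \<phi>B E \<iota> \<pi> 0 [:k:]) \<and>
          (\<forall>(E :: ('e, 'r) cmod) \<iota> \<pi>.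
             extension R C E V \<iota> \<pi> \<and> presented_by A B c \<eta> v \<phi>A \<phi>B E \<iota> \<pi> 0 [:k:] \<longrightarrow>
             \<not> trivial_ext C E V \<iota> \<pi>))) \<and>
     (p \<noteq> 0 \<and> Q1 = 0 \<longrightarrow> Ext_has_dim R V C (if \<phi>A + p = 0 then 1 else 0))"
proof -
  interpret rank_two_module_pair R A B p Q1 V v \<phi>A \<phi>B C c \<eta>
    using assms by (intro rank_two_module_pair.intro rank_two_module_pair_axioms.intro)
  have presented: "\<exists>f g. presented_by A B c \<eta> v \<phi>A \<phi>B E \<iota> \<pi> f g"
    if "extension R C E V \<iota> \<pi>" for E :: "('e, 'r) cmod" and \<iota> \<pi>
  proof -
    interpret E: rank_two_extension R A B p Q1 V v \<phi>A \<phi>B C c \<eta> E \<iota> \<pi>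
      by (rule rank_two_extensionI) (rule that)
    show ?thesis
      using E.ex_lift_action by (simp add: E.presented_by_iff_lift_action) blast
  qed
  have nontrivial: "p \<noteq> 0" "Q1 = 0" "\<phi>A = - p" "\<phi>B = 0"
    and standard: "\<exists>k. k \<noteq> 0 \<and> (\<exists>(E' :: ('c \<times> 'v, 'r) cmod) \<iota>' \<pi>'.
       extension R C E' V \<iota>' \<pi>' \<and> equivalent_ext E \<iota> \<pi> E' \<iota>' \<pi>' \<and>
       presented_by A B c \<eta> v \<phi>A \<phi>B E' \<iota>' \<pi>' 0 [:k:])"
    if E: "extension R C E V \<iota> \<pi> \<and> \<not> trivial_ext C E V \<iota> \<pi>"
    for E :: "('e, 'r) cmod" and \<iota> \<pi>
  proof -
    interpret E: rank_two_extension R A B p Q1 V v \<phi>A \<phi>B C c \<eta> E \<iota> \<pi>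
      by (rule rank_two_extensionI) (rule conjunct1[OF E])
    note nt = E.nontrivial_extension[OF conjunct2[OF E]]
    show "p \<noteq> 0" "Q1 = 0" "\<phi>A = - p" "\<phi>B = 0" by (rule nt)+
    obtain v' k where k: "k \<noteq> 0" and lift: "E.lift_action v' 0 [:k:]"
      using nt(5) by blast
    show "\<exists>k. k \<noteq> 0 \<and> (\<exists>(E' :: ('c \<times> 'v, 'r) cmod) \<iota>' \<pi>'.
       extension R C E' V \<iota>' \<pi>' \<and> equivalent_ext E \<iota> \<pi> E' \<iota>' \<pi>' \<and>
       presented_by A B c \<eta> v \<phi>A \<phi>B E' \<iota>' \<pi>' 0 [:k:])"
      using k extension_std_cochain[OF nt(1,3)] E.equivalent_std_cochain[OF nt(1,3) lift]
        presented_by_std_cochain[OF nt(1,3)]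
      by blast
  qed
  have converse: "\<exists>(E :: ('c \<times> 'v, 'r) cmod) \<iota> \<pi>.
      extension R C E V \<iota> \<pi> \<and> \<not> trivial_ext C E V \<iota> \<pi> \<and>
      presented_by A B c \<eta> v \<phi>A \<phi>B E \<iota> \<pi> 0 [:k:]"
    if "p \<noteq> 0" and "\<phi>A = - p" and "k \<noteq> 0" for k
    using extension_std_cochain[OF that(1,2)] presented_by_std_cochain[OF that(1,2), of k]
      not_trivial_if_presented_by[OF _ _ phiB_eq_0[OF that(1)]] that(3)
    by (metis pCons_eq_0_iff)
  have dim: "Ext_has_dim R V C (if \<phi>A + p = 0 then 1 else 0)" if "p \<noteq> 0"
    using Ext_dim_0 Ext_dim_1[OF that] by (simp add: eq_neg_iff_add_eq_0)
  show ?thesis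
  proof (intro conjI allI impI)
    fix E :: "('e, 'r) cmod" and \<iota> \<pi>
    assume "extension R C E V \<iota> \<pi>"
    then show "\<exists>f g. presented_by A B c \<eta> v \<phi>A \<phi>B E \<iota> \<pi> f g" by (rule presented)
  next
    fix E :: "('e, 'r) cmod" and \<iota> \<pi>
    assume E: "extension R C E V \<iota> \<pi> \<and> \<not> trivial_ext C E V \<iota> \<pi>"
    show "p \<noteq> 0" "Q1 = 0" "\<phi>A = - p" "\<phi>B = 0" by (rule nontrivial[OF E])+
    show "\<exists>k. k \<noteq> 0 \<and> (\<exists>(E' :: ('c \<times> 'v, 'r) cmod) \<iota>' \<pi>'.
       extension R C E' V \<iota>' \<pi>' \<and> equivalent_ext E \<iota> \<pi> E' \<iota>' \<pi>' \<and>
       presented_by A B c \<eta> v \<phi>A \<phi>B E' \<iota>' \<pi>' 0 [:k:])"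
      by (rule standard[OF E])
  next
    fix k :: complex
    assume "p \<noteq> 0 \<and> Q1 = 0 \<and> \<phi>A = - p \<and> \<phi>B = 0" and "k \<noteq> 0"
    then show "\<exists>(E :: ('c \<times> 'v, 'r) cmod) \<iota> \<pi>.
      extension R C E V \<iota> \<pi> \<and> \<not> trivial_ext C E V \<iota> \<pi> \<and>
      presented_by A B c \<eta> v \<phi>A \<phi>B E \<iota> \<pi> 0 [:k:]"
      by (intro converse) simp_all
  next
    fix k :: complex and E :: "('e, 'r) cmod" and \<iota> \<pi>
    assume "p \<noteq> 0 \<and> Q1 = 0 \<and> \<phi>A = - p \<and> \<phi>B = 0" and "k \<noteq> 0"
      and "extension R C E V \<iota> \<pi> \<and> presented_by A B c \<eta> v \<phi>A \<phi>B E \<iota> \<pi> 0 [:k:]"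
    then show "\<not> trivial_ext C E V \<iota> \<pi>"
      by (intro not_trivial_if_presented_by[where f = 0 and g = "[:k:]"]) simp_all
  next
    assume "p \<noteq> 0 \<and> Q1 = 0"
    then show "Ext_has_dim R V C (if \<phi>A + p = 0 then 1 else 0)"
      by (intro dim) simp
  qed
qed

end
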